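(* Let $A_0\in\mathbb{C}^{n\times n}$ be a fixed matrix and let $A_0=U_0T_0U_0^*$ be a fixed Schur decomposition of $A_0$. Then there exists $M>0$ such that in any neighborhood $\{A:\|A-A_0\|<\varepsilon\}$ of $A_0$, for any $\varepsilon>0$, $$\sup_{A}\ \inf_{U,T}\ \bigl(\|U-U_0\|+\|T-T_0\|\bigr)>M>0,$$ where the supremum is taken over all $A$ in this neighborhood having Gohberg-Kaashoek numbers different from those of $A_0$, and, for each such $A$, the infimum is taken over all Schur factorizations $A=UTU^*$ of $A$.
   Context: A Schur decomposition (Schur factorization) of $A\in\mathbb{C}^{n\times n}$ is a factorization $A=UTU^*$ with $U\in\mathbb{C}^{n\times n}$ unitary and $T\in\mathbb{C}^{n\times n}$ upper triangular. The norm $\|\cdot\|$ is the operator norm on $\mathbb{C}^{n\times n}$ induced by the Euclidean norm. Gohberg-Kaashoek (GK) numbers: let $\sigma(A)$ be the set of all eigenvalues of $A\in\mathbb{C}^{n\times n}$. For $\lambda\in\sigma(A)$ let $m_1(A,\lambda)\ge m_2(A,\lambda)\ge\dots\ge m_t(A,\lambda)$ be the sizes of all Jordan blocks corresponding to $\lambda$ in the Jordan form of $A$ (here $t$ depends on $\lambda$), and set $m_i(A,\lambda)=0$ for $i=t+1,\dots,n$. The Gohberg-Kaashoek numbers of $A$ are $m_i(A)=\sum_{\lambda\in\sigma(A)}m_i(A,\lambda)$, $i=1,\dots,n$. Two matrices have different GK numbers if $m_i$ differs for at least one $i$.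
   Formalization: The inequality is asserted for every ε>0 whose neighborhood contains at least one A with Gohberg-Kaashoek numbers different from those of A₀; otherwise (e.g. n=1, or A₀ with one Jordan block per eigenvalue and small ε) the supremum is over the empty set and the claim fails. *)

theory Defs
  imports
    "HOL-Analysis.L2_Norm"
    "HOL-Library.Extended_Real"
    "Jordan_Normal_Form.Schur_Decomposition"
    "Jordan_Normal_Form.Spectral_Radius"
    "Jordan_Normal_Form.Jordan_Normal_Form_Existence"
    "Jordan_Normal_Form.Jordan_Normal_Form_Uniqueness"
begin

definition vec_l2norm :: "complex vec \<Rightarrow> real" where
  "vec_l2norm v = L2_set (\<lambda>i. cmod (v $ i)) {..<dim_vec v}"

definition mat_opnorm :: "complex mat \<Rightarrow> real" where
  "mat_opnorm A =
     (SUP v \<in> {v \<in> carrier_vec (dim_col A). vec_l2norm v \<le> 1}. vec_l2norm (A *\<^sub>v v))"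

definition unitary_mat :: "nat \<Rightarrow> complex mat \<Rightarrow> bool" where
  "unitary_mat n U \<longleftrightarrow>
     U \<in> carrier_mat n n \<and> U * mat_adjoint U = 1\<^sub>m n \<and> mat_adjoint U * U = 1\<^sub>m n"

definition schur_factorizations :: "nat \<Rightarrow> complex mat \<Rightarrow> (complex mat \<times> complex mat) set" where
  "schur_factorizations n A =
     {(U, T). unitary_mat n U \<and> T \<in> carrier_mat n n \<and> upper_triangular T
            \<and> A = U * T * mat_adjoint U}"

(* The entries (k, \<mu>) of a Jordan normal form list the block sizes k with their eigenvalues.
   The normal form is unique only up to the order of its blocks, which sorting makes irrelevant;
   see jordan_block_sizes_eq below. *)
definition jordan_block_sizes :: "complex mat \<Rightarrow> complex \<Rightarrow> nat list" where
  "jordan_block_sizes A \<mu> =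
     rev (sort (map fst (filter (\<lambda>b. snd b = \<mu>) (SOME bs. jordan_nf A bs))))"

(* Indices start at 1; there is padding by 0 beyond the number of blocks. *)
definition jordan_size :: "nat \<Rightarrow> complex mat \<Rightarrow> complex \<Rightarrow> nat" where
  "jordan_size i A \<mu> =
     (if 1 \<le> i \<and> i \<le> length (jordan_block_sizes A \<mu>) then jordan_block_sizes A \<mu> ! (i - 1) else 0)"

definition gk_number :: "nat \<Rightarrow> complex mat \<Rightarrow> nat" where
  "gk_number i A = (\<Sum>\<mu>\<in>spectrum A. jordan_size i A \<mu>)"

definition gk_different :: "nat \<Rightarrow> complex mat \<Rightarrow> complex mat \<Rightarrow> bool" where
  "gk_different n A B \<longleftrightarrow> (\<exists>i\<in>{1..n}. gk_number i A \<noteq> gk_number i B)"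

(* This set is empty for all small \<epsilon> when every eigenvalue of A\<^sub>0 has a single Jordan block (in
   particular always for n = 1), because nearby matrices then have the same numbers n, 0, ..., 0.
   A lower bound on a supremum over it therefore needs the set to be nonempty. *)
definition gk_different_nbhd :: "nat \<Rightarrow> complex mat \<Rightarrow> real \<Rightarrow> complex mat set" where
  "gk_different_nbhd n A\<^sub>0 \<epsilon> =
     {A \<in> carrier_mat n n. mat_opnorm (A - A\<^sub>0) < \<epsilon> \<and> gk_different n A A\<^sub>0}"

lemma jordan_nf_mset_unique:
  assumes "jordan_nf (A :: complex mat) bs" "jordan_nf A cs"
  shows "mset bs = mset cs"
proof (rule multiset_eqI)
  fix x :: "nat \<times> complex"
  obtain k e where x: "x = (k, e)" by (cases x)
  show "count (mset bs) x = count (mset cs) x"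
  proof (cases "k = 0")
    case True
    then have "x \<notin> set bs" "x \<notin> set cs"
      using assms x unfolding jordan_nf_def by force+
    then show ?thesis by (metis count_eq_zero_iff set_mset_mset)
  next
    case False
    have "length (filter ((=) (k, e)) bs) = length (filter ((=) (k, e)) cs)"
      using compute_nr_of_jordan_blocks[OF assms(1) False]
        compute_nr_of_jordan_blocks[OF assms(2) False] by metis
    then show ?thesis using x by (simp add: count_mset count_list_eq_length_filter)
  qed
qed

lemma jordan_block_sizes_eq:
  assumes "jordan_nf A bs"
  shows "jordan_block_sizes A \<mu> = rev (sort (map fst (filter (\<lambda>b. snd b = \<mu>) bs)))"
proof -
  have "mset (SOME bs. jordan_nf A bs) = mset bs"
    using jordan_nf_mset_unique[OF someI[of "jordan_nf A", OF assms] assms] .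
  then show ?thesis
    unfolding jordan_block_sizes_def
    by (intro arg_cong[where f = rev] properties_for_sort) (simp_all add: mset_map mset_filter)
qed

end

theory Submission
  imports Defs
begin

text \<open>
  A claim about every radius reduces to a claim about sequences. If no bound \<open>M\<close> worked, there would
  be radii \<open>\<epsilon> k\<close> with nonempty sets of admissible matrices such that \<^emph>\<open>every\<close> admissible
  matrix within \<open>\<epsilon> k\<close> of \<open>A\<^sub>0\<close> has a Schur factorization within \<open>2 / (k + 1)\<close> of
  \<open>(U\<^sub>0, T\<^sub>0)\<close>. Picking one admissible matrix for each \<open>k\<close> gives a sequence that
  converges to \<open>A\<^sub>0\<close>, because \<open>U T U\<^sup>*\<close> depends continuously on \<open>(U, T)\<close>.

  Call a matrix nonderogatory if every eigenvalue has a single Jordan block; its numbers are then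
  \<open>n, 0, \<dots>, 0\<close>. The matrix \<open>A\<^sub>0\<close> is derogatory: otherwise the sequence just found would
  consist of derogatory matrices, and limits of derogatory matrices are derogatory
  (\<open>derogatory_limit\<close>), since \<open>dim ker B \<ge> 2\<close> means that \<open>det (B + x y\<^sup>T) = 0\<close> for all
  \<open>x\<close> and \<open>y\<close>, which is a closed condition. Hence every nonderogatory matrix near \<open>A\<^sub>0\<close> is
  admissible, and a contradiction arises from nonderogatory \<open>B k\<close>, tending to \<open>A\<^sub>0\<close> as fast as the
  radii require, whose invariant flags stay away from the one given by \<open>U\<^sub>0\<close>
  (\<open>derogatory_schur_far\<close>).

  One eigenvector suffices to see this. Let \<open>\<mu>\<close> be an eigenvalue of \<open>A\<^sub>0\<close> with at least
  two blocks and \<open>j\<close> its first position on the diagonal of \<open>T\<^sub>0\<close>. For triangular \<open>T\<close> the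
  vector \<open>(T - t\<^sub>0) \<cdots> (T - t\<^bsub>j-1\<^esub>) e\<^sub>j\<close> is annihilated by \<open>T - t\<^sub>j\<close> and is a polynomial in the
  entries of \<open>T\<close>. So if the Schur factorizations of \<open>B k\<close> converge to \<open>(U\<^sub>0, T\<^sub>0)\<close>,
  then \<open>B k\<close> has eigenvectors \<open>u k\<close> with eigenvalues \<open>\<mu> + \<zeta> k\<close>, where \<open>\<zeta> k\<close> tends to \<open>0\<close> and
  \<open>u k\<close> to a nonzero eigenvector \<open>v\<close> of \<open>A\<^sub>0\<close>.

  Put \<open>N = A\<^sub>0 - \<mu>\<close>. There are a row vector \<open>w\<close> and a number \<open>p\<close> with \<open>w v \<noteq> 0\<close>,
  \<open>w N\<^bsup>p+1\<^esup> = 0\<close> and \<open>w N\<^bsup>p\<^esup> \<noteq> 0\<close>. As the left kernel of \<open>N\<close> has dimension at least two, it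
  contains some \<open>w'\<close> that is not a multiple of \<open>w N\<^bsup>p\<^esup>\<close>, and this allows a choice of \<open>x\<close> with
  \<open>w N\<^bsup>a\<^esup> x = 0\<close> for all \<open>a \<le> p\<close> and \<open>w' x = 1\<close> (\<open>exists_direction\<close>). Take \<open>y\<close> with
  \<open>y v \<noteq> 0\<close> and perturb \<open>A\<^sub>0\<close> by \<open>s x y\<^sup>T\<close>. An eigenvector \<open>u\<close> satisfies
  \<open>N u + s (y u) x = \<zeta> u\<close>; applying \<open>w, w N, \<dots>, w N\<^bsup>p\<^esup>\<close> in turn yields \<open>\<zeta>\<^bsup>p+1\<^esup> (w u) = 0\<close>, and
  applying \<open>w'\<close> yields \<open>s (y u) = \<zeta> (w' u)\<close>. If \<open>u\<close> is close to \<open>v\<close>, then \<open>w u\<close> and \<open>y u\<close> are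
  nonzero, which is impossible. The argument survives a further error of size \<open>o(s\<^bsup>p+1\<^esup>)\<close>
  (\<open>no_eigenvectors_near\<close>), and such an error is enough to make the matrix nonderogatory
  (\<open>nonderogatory_dense\<close>).

  All pairings above are the bilinear product of vectors, without complex conjugation.
\<close>

section \<open>Square matrices whose kernel has dimension at least two\<close>

definition dyad :: "nat \<Rightarrow> 'a::semiring_0 vec \<Rightarrow> 'a vec \<Rightarrow> 'a mat" where
  "dyad n x y = mat n n (\<lambda>(i, j). x $ i * y $ j)"

lemma dyad_carrier [simp]: "dyad n x y \<in> carrier_mat n n"
  by (simp add: dyad_def)

lemma dyad_mult_vec:
  fixes x y u :: "'a::comm_semiring_0 vec"
  assumes "x \<in> carrier_vec n" "y \<in> carrier_vec n" "u \<in> carrier_vec n"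
  shows "dyad n x y *\<^sub>v u = (y \<bullet> u) \<cdot>\<^sub>v x"
  using assms
  by (intro eq_vecI)
    (auto simp: dyad_def scalar_prod_def sum_distrib_left ac_simps)

lemma transpose_dyad: "(dyad n x y)\<^sup>T = dyad n y (x :: 'a::comm_semiring_0 vec)"
  by (intro eq_matI) (auto simp: dyad_def ac_simps)

text \<open>
  The kernel of \<open>B\<close> meets every hyperplane nontrivially: this says that it has dimension at least
  two, in a form that needs no bases.
\<close>

definition corank_ge2 :: "nat \<Rightarrow> 'a::field mat \<Rightarrow> bool" where
  "corank_ge2 n B \<longleftrightarrow>
     (\<forall>y \<in> carrier_vec n. \<exists>u \<in> carrier_vec n. u \<noteq> 0\<^sub>v n \<and> B *\<^sub>v u = 0\<^sub>v n \<and> y \<bullet> u = 0)"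

lemma zero_smult_vec_dim [simp]: "(0 :: 'a::semiring_0) \<cdot>\<^sub>v v = 0\<^sub>v (dim_vec v)"
  by (intro eq_vecI) auto

lemma mult_mat_zero_vec [simp]:
  "dim_col A = n \<Longrightarrow> A *\<^sub>v 0\<^sub>v n = (0\<^sub>v (dim_row A) :: 'a::semiring_0 vec)"
  by (intro eq_vecI) (auto simp: scalar_prod_def)

lemma scalar_prod_mat_mult_vec:
  fixes B :: "'a::comm_semiring_0 mat"
  assumes "B \<in> carrier_mat n n" "w \<in> carrier_vec n" "u \<in> carrier_vec n"
  shows "w \<bullet> (B *\<^sub>v u) = (B\<^sup>T *\<^sub>v w) \<bullet> u"
  using transpose_vec_mult_scalar[OF assms(1,3,2)] assms
  by (metis comm_scalar_prod mult_mat_vec_carrier transpose_carrier_mat)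

text \<open>
  A rank-one term can repair a kernel of dimension one but not a larger one. The determinants make
  the property closed under limits and invariant under transposition.
\<close>

lemma corank_ge2_iff_det:
  assumes B: "B \<in> carrier_mat n n"
  shows "corank_ge2 n B \<longleftrightarrow>
    (\<forall>x \<in> carrier_vec n. \<forall>y \<in> carrier_vec n. det (B + dyad n x y) = 0)"
proof (intro iffI ballI)
  fix x y :: "'a vec"
  assume c: "corank_ge2 n B" and x: "x \<in> carrier_vec n" and y: "y \<in> carrier_vec n"
  obtain u where u: "u \<in> carrier_vec n" "u \<noteq> 0\<^sub>v n" "B *\<^sub>v u = 0\<^sub>v n" "y \<bullet> u = 0"
    using c y unfolding corank_ge2_def by blast
  have "(B + dyad n x y) *\<^sub>v u = 0\<^sub>v n"
    using u x y B by (auto simp: add_mult_distrib_mat_vec[of _ n n] dyad_mult_vec)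
  then show "det (B + dyad n x y) = 0"
    using u B by (subst det_0_iff_vec_prod_zero[of _ n]) auto
next
  assume d: "\<forall>x \<in> carrier_vec n. \<forall>y \<in> carrier_vec n. det (B + dyad n x y) = 0"
  show "corank_ge2 n B"
    unfolding corank_ge2_def
  proof
    fix y :: "'a vec" assume y: "y \<in> carrier_vec n"
    have "dyad n (0\<^sub>v n) y = 0\<^sub>m n n"
      by (intro eq_matI) (auto simp: dyad_def)
    then have "det B = 0"
      using d B y by (metis right_add_zero_mat zero_carrier_vec)
    then have "det B\<^sup>T = 0" using B by (simp add: det_transpose)
    then obtain w where w: "w \<in> carrier_vec n" "w \<noteq> 0\<^sub>v n" "B\<^sup>T *\<^sub>v w = 0\<^sub>v n"
      using det_0_iff_vec_prod_zero[of "B\<^sup>T" n] B by auto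
    \<comment> \<open>The unit vector at \<open>i\<close> pairs nontrivially with the left null vector \<open>w\<close>, so it is not in the image of \<open>B\<close>.\<close>
    obtain i where i: "i < n" "w $ i \<noteq> 0"
      using w by (metis eq_vecI carrier_vecD index_zero_vec)
    have x: "unit_vec n i \<in> carrier_vec n" by simp
    obtain u where u: "u \<in> carrier_vec n" "u \<noteq> 0\<^sub>v n"
      and eq: "(B + dyad n (unit_vec n i) y) *\<^sub>v u = 0\<^sub>v n"
      using d x y det_0_iff_vec_prod_zero[of "B + dyad n (unit_vec n i) y" n] B by auto
    have eq': "B *\<^sub>v u + (y \<bullet> u) \<cdot>\<^sub>v unit_vec n i = 0\<^sub>v n"
      using eq u B y by (simp add: add_mult_distrib_mat_vec[of _ n n] dyad_mult_vec)
    have "0 = w \<bullet> (B *\<^sub>v u + (y \<bullet> u) \<cdot>\<^sub>v unit_vec n i)"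
      using eq' w by simp
    also have "\<dots> = w \<bullet> (B *\<^sub>v u) + (y \<bullet> u) * (w \<bullet> unit_vec n i)"
      using w u B by (simp add: scalar_prod_add_distrib[of _ n])
    also have "w \<bullet> (B *\<^sub>v u) = 0"
      using w u B by (simp add: scalar_prod_mat_mult_vec[of B n])
    finally have "y \<bullet> u = 0" using i w by simp
    moreover have "B *\<^sub>v u = 0\<^sub>v n"
      using eq' \<open>y \<bullet> u = 0\<close> u B by (simp add: right_zero_vec[of _ n])
    ultimately show "\<exists>u \<in> carrier_vec n. u \<noteq> 0\<^sub>v n \<and> B *\<^sub>v u = 0\<^sub>v n \<and> y \<bullet> u = 0"
      using u by blast
  qed
qed

lemma corank_ge2_transpose:
  assumes "B \<in> carrier_mat n n" "corank_ge2 n B"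
  shows "corank_ge2 n B\<^sup>T"
proof -
  have "B\<^sup>T + dyad n x y = (B + dyad n y x)\<^sup>T" for x y
    using assms(1) transpose_add[of B n n "dyad n y x"] by (simp add: transpose_dyad)
  then have "det (B\<^sup>T + dyad n x y) = det (B + dyad n y x)" for x y
    using assms(1) det_transpose[of "B + dyad n y x" n] by simp
  then show ?thesis using assms by (simp add: corank_ge2_iff_det)
qed

lemma corank_ge2_similar:
  assumes "similar_mat_wit A B P Q" "A \<in> carrier_mat n n" "corank_ge2 n A"
  shows "corank_ge2 n B"
  unfolding corank_ge2_def
proof
  note wit = similar_mat_witD2[OF assms(2,1)]
  fix y :: "'a vec" assume y: "y \<in> carrier_vec n"
  have "Q\<^sup>T *\<^sub>v y \<in> carrier_vec n" using wit y by simp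
  then obtain u where u: "u \<in> carrier_vec n" "u \<noteq> 0\<^sub>v n" "A *\<^sub>v u = 0\<^sub>v n"
    and yu: "(Q\<^sup>T *\<^sub>v y) \<bullet> u = 0"
    using assms(3) unfolding corank_ge2_def by blast
  have "P *\<^sub>v (Q *\<^sub>v u) = u" 
    using wit u by (simp flip: assoc_mult_mat_vec)
  moreover have "P *\<^sub>v 0\<^sub>v n = 0\<^sub>v n" using wit by simp
  ultimately have nz: "Q *\<^sub>v u \<noteq> 0\<^sub>v n" using u by metis
  have "B *\<^sub>v (Q *\<^sub>v u) = Q *\<^sub>v (P *\<^sub>v (B *\<^sub>v (Q *\<^sub>v u)))"
    using wit u assoc_mult_mat_vec[of Q n n P n "B *\<^sub>v (Q *\<^sub>v u)"] by simp
  also have "P *\<^sub>v (B *\<^sub>v (Q *\<^sub>v u)) = A *\<^sub>v u"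
    using wit u assoc_mult_mat_vec[of P n n "B * Q" n u] assoc_mult_mat_vec[of B n n Q n u] by simp
  finally have "B *\<^sub>v (Q *\<^sub>v u) = 0\<^sub>v n" using u wit by simp
  moreover have "y \<bullet> (Q *\<^sub>v u) = 0"
    using yu scalar_prod_mat_mult_vec[of Q n y u] wit u y by simp
  ultimately show "\<exists>u \<in> carrier_vec n. u \<noteq> 0\<^sub>v n \<and> B *\<^sub>v u = 0\<^sub>v n \<and> y \<bullet> u = 0"
    using nz u wit by (meson mult_mat_vec_carrier)
qed

lemma corank_ge2_dim:
  fixes B :: "'a::field mat"
  assumes "corank_ge2 n B" "B \<in> carrier_mat n n"
  shows "2 \<le> n"
proof (rule ccontr)
  assume n: "\<not> 2 \<le> n"
  obtain u :: "'a vec" where u: "u \<in> carrier_vec n" "u \<noteq> 0\<^sub>v n" "vec n (\<lambda>_. 1) \<bullet> u = 0"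
    using assms(1)[unfolded corank_ge2_def, rule_format, OF vec_carrier[of n "\<lambda>_. 1"]] by blast
  have "n = 0 \<or> n = 1" using n by auto
  then have "u = 0\<^sub>v n"
    using u by (intro eq_vecI) (auto simp: scalar_prod_def)
  then show False using u by simp
qed

text \<open>
  The link to Jordan forms, whose blocks are counted by kernel dimensions.
\<close>

lemma corank_ge2_iff_kernel_dim:
  assumes B: "B \<in> carrier_mat n n"
  shows "corank_ge2 n B \<longleftrightarrow> 2 \<le> kernel_dim B"
proof -
  interpret K: kernel n n B by unfold_locales (rule B)
  obtain S where S: "finite S" "K.basis S" using kernel_basis_exists[OF B] by blast
  have dim: "kernel_dim B = card S" using K.Ker.dim_basis[OF S] by simp
  have Sk: "S \<subseteq> mat_kernel B" and li: "K.lin_indpt S" and sp: "K.span S = mat_kernel B"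
    using S(2) unfolding K.Ker.basis_def by auto
  have kerD: "u \<in> carrier_vec n" "B *\<^sub>v u = 0\<^sub>v n" if "u \<in> mat_kernel B" for u
    using mat_kernelD[OF B that] by auto
  have lc: "K.lincomb a X = 0\<^sub>v n \<Longrightarrow> X \<subseteq> S \<Longrightarrow> v \<in> X \<Longrightarrow> a v = 0" for a X v
    using li S(1) finite_subset unfolding K.Ker.lin_dep_def by blast
  show ?thesis
  proof
    assume "2 \<le> kernel_dim B"
    then obtain b c where bc: "b \<in> S" "c \<in> S" "b \<noteq> c"
      using dim S(1) card_le_Suc0_iff_eq[of S] by fastforce
    show "corank_ge2 n B"
      unfolding corank_ge2_def
    proof
      fix y :: "'a vec" assume y: "y \<in> carrier_vec n"
      have c: "c \<in> carrier_vec n" "B *\<^sub>v c = 0\<^sub>v n" and b: "b \<in> carrier_vec n" "B *\<^sub>v b = 0\<^sub>v n"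
        using bc Sk kerD by auto
      have cmb: "u = 0\<^sub>v n \<Longrightarrow> \<beta> = 0 \<and> \<gamma> = 0" if u: "u = \<beta> \<cdot>\<^sub>v b + \<gamma> \<cdot>\<^sub>v c" for u \<beta> \<gamma>
      proof -
        assume "u = 0\<^sub>v n"
        let ?a = "\<lambda>v. if v = b then \<beta> else \<gamma>"
        have "K.lincomb ?a {b, c} \<in> carrier_vec n"
          using bc Sk by (intro kerD K.Ker.lincomb_closed) auto
        then have "K.lincomb ?a {b, c} = u"
          using bc Sk c b u
          by (intro eq_vecI) (subst K.lincomb_index, auto)
        then show ?thesis
          using lc[of ?a "{b, c}" b] lc[of ?a "{b, c}" c] bc \<open>u = 0\<^sub>v n\<close> by auto
      qed
      show "\<exists>u \<in> carrier_vec n. u \<noteq> 0\<^sub>v n \<and> B *\<^sub>v u = 0\<^sub>v n \<and> y \<bullet> u = 0"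
      proof (cases "y \<bullet> b = 0")
        case True
        have "b \<noteq> 0\<^sub>v n" using cmb[of b 1 0] b c by auto
        then show ?thesis using True b by blast
      next
        case False
        define u where "u = (y \<bullet> c) \<cdot>\<^sub>v b + (- (y \<bullet> b)) \<cdot>\<^sub>v c"
        have "u \<noteq> 0\<^sub>v n" using cmb[OF u_def] False by auto
        moreover have "u \<in> carrier_vec n" using b c by (simp add: u_def)
        moreover have "B *\<^sub>v u = 0\<^sub>v n"
          using b c B by (simp add: u_def mult_add_distrib_mat_vec[OF B] mult_mat_vec[OF B])
        moreover have "y \<bullet> u = 0"
          using b c y by (simp add: u_def scalar_prod_add_distrib[of _ n])
        ultimately show ?thesis by blast
      qed
    qed
  next
    assume cr: "corank_ge2 n B"
    show "2 \<le> kernel_dim B"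
    proof (rule ccontr)
      assume "\<not> 2 \<le> kernel_dim B"
      then have "card S \<le> 1" using dim by simp
      then have S1: "S = {} \<or> (\<exists>b. S = {b})"
        using S(1) by (metis One_nat_def card_0_eq card_1_singletonE le_Suc_eq le_zero_eq)
      have idx: "\<exists>a. \<forall>i<n. u $ i = (\<Sum>x\<in>S. a x * x $ i)" if "u \<in> mat_kernel B" for u
      proof -
        have "u \<in> K.span S" using that sp by simp
        then obtain a where "u = K.lincomb a S"
          using K.Ker.finite_in_span[OF S(1) Sk, of u] by metis
        then show ?thesis using K.lincomb_index[OF _ Sk] by blast
      qed
      show False
      proof (cases "S = {}")
        case True
        obtain u where "u \<in> carrier_vec n" "u \<noteq> 0\<^sub>v n" "B *\<^sub>v u = 0\<^sub>v n"
          using cr unfolding corank_ge2_def by (meson zero_carrier_vec)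
        then show False
          using idx[of u] True mat_kernelI[OF B, of u] by auto
      next
        case False
        then obtain b where b: "S = {b}" using S1 by blast
        have "b \<in> carrier_vec n" using b Sk kerD by auto
        moreover have "b \<noteq> 0\<^sub>v n"
        proof
          assume "b = 0\<^sub>v n"
          moreover have "K.lincomb (\<lambda>_. 1) {b} \<in> carrier_vec n"
            using b Sk by (intro kerD K.Ker.lincomb_closed) auto
          ultimately have "K.lincomb (\<lambda>_. 1) {b} = 0\<^sub>v n"
            using b Sk by (intro eq_vecI) (subst K.lincomb_index, auto)
          then show False using lc[of "\<lambda>_. 1" "{b}" b] b by simp
        qed
        ultimately obtain i where i: "i < n" "b $ i \<noteq> 0"
          by (metis eq_vecI carrier_vecD index_zero_vec)
        obtain u where u: "u \<in> carrier_vec n" "u \<noteq> 0\<^sub>v n" "B *\<^sub>v u = 0\<^sub>v n" "unit_vec n i \<bullet> u = 0"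
          using cr unfolding corank_ge2_def by (meson unit_vec_carrier)
        obtain a where a: "\<forall>k<n. u $ k = a * b $ k"
          using idx[of u] b u mat_kernelI[OF B, of u] by auto
        have "u $ i = 0" using u i by simp
        then have "a = 0" using a i by simp
        then show False using a u by auto
      qed
    qed
  qed
qed


section \<open>Gohberg-Kaashoek numbers and nonderogatory matrices\<close>

text \<open>
  Every eigenvalue has geometric multiplicity one, that is, a single Jordan block.
\<close>

definition nonderogatory :: "nat \<Rightarrow> complex mat \<Rightarrow> bool" where
  "nonderogatory n A \<longleftrightarrow> (\<forall>\<mu>. \<not> corank_ge2 n (char_matrix A \<mu>))"

lemma complex_jordan_nf:
  fixes A :: "complex mat"
  assumes "A \<in> carrier_mat n n"
  obtains bs where "jordan_nf A bs" "0 \<notin> fst ` set bs" "sum_list (map fst bs) = n"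
proof -
  obtain as where "char_poly A = (\<Prod>a\<leftarrow>as. [:- a, 1:])"
    using char_poly_factorized[OF assms] by blast
  then obtain bs where bs: "jordan_nf A bs"
    using jordan_nf_exists[OF assms] by blast
  moreover have "sum_list (map fst bs) = n"
  proof -
    obtain m P Q where "{A, jordan_matrix bs, P, Q} \<subseteq> carrier_mat m m"
      using bs similar_matD unfolding jordan_nf_def by blast
    then have "dim_row A = m" "dim_row (jordan_matrix bs) = m" by auto
    then show ?thesis using assms by simp
  qed
  ultimately show thesis
    using that unfolding jordan_nf_def by blast
qed

lemma block_count_eq_kernel_dim:
  assumes "jordan_nf A bs" "A \<in> carrier_mat n n"
  shows "length (filter (\<lambda>b. snd b = \<mu>) bs) = kernel_dim (char_matrix A \<mu>)"
proof -
  have "kernel_dim (char_matrix A \<mu>) = dim_gen_eigenspace A \<mu> 1"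
    using assms(2) unfolding dim_gen_eigenspace_def by simp
  also have "\<dots> = (\<Sum>k\<leftarrow>map fst (filter (\<lambda>b. snd b = \<mu>) bs). min 1 k)"
    unfolding dim_gen_eigenspace[OF assms(1)] by (simp add: case_prod_unfold)
  also have "\<dots> = length (filter (\<lambda>b. snd b = \<mu>) bs)"
  proof -
    have "0 \<notin> fst ` set bs" using assms(1) unfolding jordan_nf_def by blast
    then show ?thesis by (induction bs) auto
  qed
  finally show ?thesis by simp
qed

lemma char_matrix_carrier:
  "A \<in> carrier_mat n n \<Longrightarrow> char_matrix A \<mu> \<in> carrier_mat n n"
  by simp

lemma spectrum_eq_block_eigenvalues:
  fixes A :: "complex mat"
  assumes "jordan_nf A bs" "A \<in> carrier_mat n n"
  shows "spectrum A = snd ` set bs"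
proof -
  have "0 \<notin> fst ` set bs" using assms(1) unfolding jordan_nf_def by blast
  then have "poly (\<Prod>(k, a)\<leftarrow>bs. [:- a, 1:] ^ k) \<mu> = 0 \<longleftrightarrow> \<mu> \<in> snd ` set bs" for \<mu>
    by (induction bs) (auto simp: poly_prod_list)
  then show ?thesis
    unfolding spectrum_root_char_poly[OF assms(2)] jordan_nf_char_poly[OF assms(1)] by blast
qed

text \<open>
  With one block per eigenvalue, the first number adds up the sizes of all blocks.
\<close>

lemma gk_number_nonderogatory:
  assumes A: "A \<in> carrier_mat n n" and nd: "nonderogatory n A" and i: "1 \<le> i"
  shows "gk_number i A = (if i = 1 then n else 0)"
proof -
  obtain bs where bs: "jordan_nf A bs" "0 \<notin> fst ` set bs" "sum_list (map fst bs) = n"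
    by (rule complex_jordan_nf[OF A])
  have le1: "length (filter (\<lambda>b. snd b = \<mu>) bs) \<le> 1" for \<mu>
  proof -
    have "\<not> 2 \<le> kernel_dim (char_matrix A \<mu>)"
      using nd corank_ge2_iff_kernel_dim[OF char_matrix_carrier[OF A]]
      unfolding nonderogatory_def by blast
    then show ?thesis unfolding block_count_eq_kernel_dim[OF bs(1) A] by linarith
  qed
  have single: "filter (\<lambda>c. snd c = snd b) bs = [b]" if "b \<in> set bs" for b
  proof -
    have "b \<in> set (filter (\<lambda>c. snd c = snd b) bs)" using that by simp
    then show ?thesis using le1[of "snd b"]
      by (cases "filter (\<lambda>c. snd c = snd b) bs") auto
  qed
  have "distinct (map snd bs)"
    using le1
  proof (induction bs)
    case (Cons b bs)
    have "length (filter (\<lambda>c. snd c = \<mu>) bs) \<le> 1" for \<mu>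
      using Cons.prems[of \<mu>] by (auto split: if_splits)
    moreover have "filter (\<lambda>c. snd c = snd b) bs = []"
      using Cons.prems[of "snd b"] by simp
    ultimately show ?case using Cons.IH by (auto simp: filter_empty_conv)
  qed simp
  then have dist: "distinct bs" and inj: "inj_on snd (set bs)"
    by (simp_all add: distinct_map)
  have "jordan_size i A (snd b) = (if i = 1 then fst b else 0)" if "b \<in> set bs" for b
    unfolding jordan_size_def jordan_block_sizes_eq[OF bs(1)] single[OF that] using i by auto
  then have "gk_number i A = (\<Sum>b\<in>set bs. if i = 1 then fst b else 0)"
    unfolding gk_number_def spectrum_eq_block_eigenvalues[OF bs(1) A] sum.reindex[OF inj] by simp
  also have "\<dots> = (if i = 1 then sum_list (map fst bs) else 0)"
    using sum_list_distinct_conv_sum_set[OF dist, of fst] by simp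
  finally show ?thesis using bs(3) by simp
qed

lemma gk_number_two_derogatory:
  assumes A: "A \<in> carrier_mat n n" and d: "\<not> nonderogatory n A"
  shows "gk_number 2 A > 0"
proof -
  obtain \<mu> where \<mu>: "corank_ge2 n (char_matrix A \<mu>)" using d unfolding nonderogatory_def by blast
  obtain bs where bs: "jordan_nf A bs" "0 \<notin> fst ` set bs" "sum_list (map fst bs) = n"
    by (rule complex_jordan_nf[OF A])
  let ?ks = "jordan_block_sizes A \<mu>"
  have ks: "?ks = rev (sort (map fst (filter (\<lambda>b. snd b = \<mu>) bs)))"
    by (rule jordan_block_sizes_eq[OF bs(1)])
  have len: "2 \<le> length (filter (\<lambda>b. snd b = \<mu>) bs)"
    using \<mu> corank_ge2_iff_kernel_dim[OF char_matrix_carrier[OF A]]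
    unfolding block_count_eq_kernel_dim[OF bs(1) A] by simp
  then have len': "2 \<le> length ?ks" unfolding ks by simp
  then have "?ks ! 1 \<in> set ?ks" by simp
  then have "?ks ! 1 \<in> fst ` set bs" unfolding ks by auto
  with bs(2) have "?ks ! 1 \<noteq> 0" by (intro notI) simp
  then have pos: "jordan_size 2 A \<mu> > 0"
    using len' unfolding jordan_size_def by simp
  have "\<mu> \<in> snd ` set bs"
    using len by (metis (mono_tags, lifting) filter_False image_eqI le_zero_eq list.size(3) zero_neq_numeral)
  then have "\<mu> \<in> spectrum A" unfolding spectrum_eq_block_eigenvalues[OF bs(1) A] .
  then have "jordan_size 2 A \<mu> \<le> gk_number 2 A"
    unfolding gk_number_def using card_finite_spectrum(1)[OF A] by (intro member_le_sum) auto
  then show ?thesis using pos by simp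
qed

lemma gk_different_nonderogatory_derogatory:
  assumes A: "A \<in> carrier_mat n n" "nonderogatory n A"
    and B: "B \<in> carrier_mat n n" "\<not> nonderogatory n B"
  shows "gk_different n A B"
proof -
  have "2 \<le> n" using B corank_ge2_dim char_matrix_carrier unfolding nonderogatory_def by blast
  moreover have "gk_number 2 A \<noteq> gk_number 2 B"
    using gk_number_nonderogatory[OF A, of 2] gk_number_two_derogatory[OF B] by simp
  ultimately show ?thesis unfolding gk_different_def by (intro bexI[of _ 2]) auto
qed

lemma not_gk_different_nonderogatory:
  assumes "A \<in> carrier_mat n n" "nonderogatory n A"
    and "B \<in> carrier_mat n n" "nonderogatory n B"
  shows "\<not> gk_different n A B"
  using gk_number_nonderogatory[OF assms(1,2)] gk_number_nonderogatory[OF assms(3,4)]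
  unfolding gk_different_def by auto


section \<open>Entrywise limits and the operator norm\<close>

text \<open>
  Matrices of varying size share one type, which therefore carries no topology; convergence is
  convergence of all entries.
\<close>

definition mat_lim :: "nat \<Rightarrow> (nat \<Rightarrow> complex mat) \<Rightarrow> complex mat \<Rightarrow> bool" where
  "mat_lim n X L \<longleftrightarrow> (\<forall>k. X k \<in> carrier_mat n n) \<and> L \<in> carrier_mat n n \<and>
     (\<forall>i<n. \<forall>j<n. (\<lambda>k. X k $$ (i, j)) \<longlonglongrightarrow> L $$ (i, j))"

definition vec_lim :: "nat \<Rightarrow> (nat \<Rightarrow> complex vec) \<Rightarrow> complex vec \<Rightarrow> bool" where
  "vec_lim n x l \<longleftrightarrow> (\<forall>k. x k \<in> carrier_vec n) \<and> l \<in> carrier_vec n \<and>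
     (\<forall>i<n. (\<lambda>k. x k $ i) \<longlonglongrightarrow> l $ i)"

lemma mat_limD:
  assumes "mat_lim n X L"
  shows "X k \<in> carrier_mat n n" "L \<in> carrier_mat n n"
    "i < n \<Longrightarrow> j < n \<Longrightarrow> (\<lambda>k. X k $$ (i, j)) \<longlonglongrightarrow> L $$ (i, j)"
  using assms unfolding mat_lim_def by auto

lemma mat_lim_dim:
  assumes "mat_lim n X L"
  shows "dim_row (X k) = n" "dim_col (X k) = n" "dim_row L = n" "dim_col L = n"
  using assms unfolding mat_lim_def by (auto dest: carrier_matD)

lemma vec_limD:
  assumes "vec_lim n x l"
  shows "x k \<in> carrier_vec n" "l \<in> carrier_vec n" "i < n \<Longrightarrow> (\<lambda>k. x k $ i) \<longlonglongrightarrow> l $ i"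
  using assms unfolding vec_lim_def by auto

lemma mat_lim_const: "L \<in> carrier_mat n n \<Longrightarrow> mat_lim n (\<lambda>_. L) L"
  unfolding mat_lim_def by simp

lemma vec_lim_const: "l \<in> carrier_vec n \<Longrightarrow> vec_lim n (\<lambda>_. l) l"
  unfolding vec_lim_def by simp

lemma mat_lim_subseq:
  assumes "mat_lim n X L" "strict_mono r"
  shows "mat_lim n (\<lambda>k. X (r k)) L"
  using assms LIMSEQ_subseq_LIMSEQ[of _ _ r] unfolding mat_lim_def comp_def by blast

lemma scalar_prod_lim:
  assumes "vec_lim n x l" "vec_lim n y m"
  shows "(\<lambda>k. x k \<bullet> y k) \<longlonglongrightarrow> l \<bullet> m"
proof -
  have "dim_vec (y k) = n" "dim_vec m = n" for k
    using vec_limD(1,2)[OF assms(2)] by auto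
  then show ?thesis
    unfolding scalar_prod_def
    using vec_limD(3)[OF assms(1)] vec_limD(3)[OF assms(2)]
    by (auto intro!: tendsto_sum tendsto_mult)
qed

lemma mult_mat_vec_lim:
  assumes "mat_lim n X L" "vec_lim n x l"
  shows "vec_lim n (\<lambda>k. X k *\<^sub>v x k) (L *\<^sub>v l)"
proof -
  have "vec_lim n (\<lambda>k. row (X k) i) (row L i)" if "i < n" for i
    using mat_lim_dim[OF assms(1)] mat_limD(3)[OF assms(1)] that unfolding vec_lim_def
    by (auto intro!: carrier_vecI)
  then have "(\<lambda>k. row (X k) i \<bullet> x k) \<longlonglongrightarrow> row L i \<bullet> l" if "i < n" for i
    using scalar_prod_lim assms(2) that by blast
  then show ?thesis
    using mat_lim_dim[OF assms(1)] unfolding vec_lim_def by (auto intro!: carrier_vecI)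
qed

lemma mult_mat_lim:
  assumes "mat_lim n X L" "mat_lim n Y M"
  shows "mat_lim n (\<lambda>k. X k * Y k) (L * M)"
proof -
  have row: "vec_lim n (\<lambda>k. row (X k) i) (row L i)" if "i < n" for i
    using mat_lim_dim[OF assms(1)] mat_limD(3)[OF assms(1)] that unfolding vec_lim_def
    by (auto intro!: carrier_vecI)
  have col: "vec_lim n (\<lambda>k. col (Y k) j) (col M j)" if "j < n" for j
    using mat_lim_dim[OF assms(2)] mat_limD(3)[OF assms(2)] that unfolding vec_lim_def
    by (auto intro!: carrier_vecI)
  have "(\<lambda>k. row (X k) i \<bullet> col (Y k) j) \<longlonglongrightarrow> row L i \<bullet> col M j" if "i < n" "j < n" for i j
    using scalar_prod_lim row col that by blast
  then show ?thesis
    using mat_lim_dim[OF assms(1)] mat_lim_dim[OF assms(2)]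
    unfolding mat_lim_def by (auto intro!: carrier_matI)
qed

lemma add_mat_lim:
  assumes "mat_lim n X L" "mat_lim n Y M"
  shows "mat_lim n (\<lambda>k. X k + Y k) (L + M)"
  using mat_lim_dim[OF assms(1)] mat_lim_dim[OF assms(2)] mat_limD(3)[OF assms(1)] mat_limD(3)[OF assms(2)]
  unfolding mat_lim_def by (auto intro!: carrier_matI tendsto_add)

lemma char_matrix_lim:
  assumes "mat_lim n X L" "z \<longlonglongrightarrow> \<zeta>"
  shows "mat_lim n (\<lambda>k. char_matrix (X k) (z k)) (char_matrix L \<zeta>)"
proof -
  note dim = mat_lim_dim[OF assms(1)]
  have idx: "char_matrix M a $$ (i, j) = M $$ (i, j) - a * (if i = j then 1 else 0)"
    if "dim_row M = n" "dim_col M = n" "i < n" "j < n" for M :: "complex mat" and a i j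
    using that unfolding char_matrix_def by simp
  have "(\<lambda>k. char_matrix (X k) (z k) $$ (i, j)) \<longlonglongrightarrow> char_matrix L \<zeta> $$ (i, j)"
    if "i < n" "j < n" for i j
    unfolding idx[OF dim(1,2) that] idx[OF dim(3,4) that]
    by (intro tendsto_diff tendsto_mult tendsto_const mat_limD(3)[OF assms(1)] assms(2) that)
  then show ?thesis
    using mat_limD(1,2)[OF assms(1)] unfolding mat_lim_def by simp
qed

lemma det_lim:
  assumes "mat_lim n X L"
  shows "(\<lambda>k. det (X k)) \<longlonglongrightarrow> det L"
proof -
  have "p i < n" if "p permutes {0..<n}" "i < n" for p i
    using permutes_in_image[OF that(1), of i] that(2) by simp
  then show ?thesis
    unfolding det_def'[OF mat_limD(1)[OF assms]] det_def'[OF mat_limD(2)[OF assms]]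
    using mat_limD(3)[OF assms]
    by (intro tendsto_sum tendsto_mult tendsto_const tendsto_prod) auto
qed

lemma mat_adjoint_carrier [simp]:
  "U \<in> carrier_mat n n \<Longrightarrow> mat_adjoint U \<in> carrier_mat n n"
  unfolding mat_adjoint_def by (auto simp: mat_of_rows_def)

lemma mat_adjoint_index:
  fixes U :: "complex mat"
  assumes "U \<in> carrier_mat n n" "i < n" "j < n"
  shows "mat_adjoint U $$ (i, j) = cnj (U $$ (j, i))"
  using assms unfolding mat_adjoint_def by (simp add: mat_of_rows_index)

lemma mat_adjoint_lim:
  assumes "mat_lim n X L"
  shows "mat_lim n (\<lambda>k. mat_adjoint (X k)) (mat_adjoint L)"
proof -
  note c = mat_limD(1)[OF assms] mat_limD(2)[OF assms]
  have "(\<lambda>k. mat_adjoint (X k) $$ (i, j)) \<longlonglongrightarrow> mat_adjoint L $$ (i, j)" if "i < n" "j < n" for i j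
    using mat_limD(3)[OF assms that(2,1)] mat_adjoint_index[OF c(1) that] mat_adjoint_index[OF c(2) that]
    by (simp add: tendsto_cnj)
  then show ?thesis using c unfolding mat_lim_def by simp
qed

lemma l2norm_mult_le:
  assumes M: "M \<in> carrier_mat n n" and v: "v \<in> carrier_vec n" "vec_l2norm v \<le> 1"
  shows "vec_l2norm (M *\<^sub>v v) \<le> (\<Sum>i<n. \<Sum>j<n. cmod (M $$ (i, j)))"
proof -
  have v1: "cmod (v $ j) \<le> 1" if "j < n" for j
    using member_le_L2_set[of "{..<n}" j "\<lambda>i. cmod (v $ i)"] that v
    unfolding vec_l2norm_def by auto
  have "vec_l2norm (M *\<^sub>v v) \<le> (\<Sum>i<n. cmod ((M *\<^sub>v v) $ i))"
    unfolding vec_l2norm_def using M by (auto intro: L2_set_le_sum simp del: index_mult_mat_vec)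
  also have "\<dots> \<le> (\<Sum>i<n. \<Sum>j<n. cmod (M $$ (i, j)))"
  proof (intro sum_mono)
    fix i assume "i \<in> {..<n}"
    then have "(M *\<^sub>v v) $ i = (\<Sum>j<n. M $$ (i, j) * v $ j)"
      using M v by (auto simp: scalar_prod_def lessThan_atLeast0 intro!: sum.cong)
    also have "cmod \<dots> \<le> (\<Sum>j<n. cmod (M $$ (i, j) * v $ j))" by (rule norm_sum)
    also have "\<dots> \<le> (\<Sum>j<n. cmod (M $$ (i, j)))"
      using v1 by (intro sum_mono) (auto simp: norm_mult mult_left_le)
    finally show "cmod ((M *\<^sub>v v) $ i) \<le> (\<Sum>j<n. cmod (M $$ (i, j)))" .
  qed
  finally show ?thesis .
qed

lemma vec_l2norm_zero: "vec_l2norm (0\<^sub>v n) = 0"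
  unfolding vec_l2norm_def by (simp add: L2_set_def)

lemma opnorm_le_sum:
  assumes M: "M \<in> carrier_mat n n"
  shows "mat_opnorm M \<le> (\<Sum>i<n. \<Sum>j<n. cmod (M $$ (i, j)))"
  unfolding mat_opnorm_def
proof (rule cSUP_least)
  show "{v \<in> carrier_vec (dim_col M). vec_l2norm v \<le> 1} \<noteq> {}"
    using vec_l2norm_zero[of "dim_col M"] by (auto intro!: exI[of _ "0\<^sub>v (dim_col M)"])
qed (use M l2norm_mult_le[OF M] in auto)

lemma l2norm_mult_le_opnorm:
  assumes M: "M \<in> carrier_mat n n" and v: "v \<in> carrier_vec n" "vec_l2norm v \<le> 1"
  shows "vec_l2norm (M *\<^sub>v v) \<le> mat_opnorm M"
  unfolding mat_opnorm_def
proof (rule cSUP_upper)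
  show "bdd_above ((\<lambda>v. vec_l2norm (M *\<^sub>v v)) ` {v \<in> carrier_vec (dim_col M). vec_l2norm v \<le> 1})"
    using l2norm_mult_le[OF M] M by (intro bdd_aboveI2) auto
qed (use M v in auto)

lemma opnorm_nonneg:
  assumes M: "M \<in> carrier_mat n n"
  shows "0 \<le> mat_opnorm M"
proof -
  have "0 \<le> vec_l2norm (M *\<^sub>v 0\<^sub>v n)" unfolding vec_l2norm_def by simp
  also have "\<dots> \<le> mat_opnorm M"
    by (rule l2norm_mult_le_opnorm[OF M]) (auto simp: vec_l2norm_zero)
  finally show ?thesis .
qed

lemma entry_le_opnorm:
  assumes M: "M \<in> carrier_mat n n" and ij: "i < n" "j < n"
  shows "cmod (M $$ (i, j)) \<le> mat_opnorm M"
proof -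
  have "(\<Sum>k<n. (cmod (unit_vec n j $ k))\<^sup>2) = (\<Sum>k<n. if k = j then 1 else 0)"
    by (intro sum.cong) (auto simp: ij)
  then have u: "vec_l2norm (unit_vec n j) \<le> 1"
    unfolding vec_l2norm_def L2_set_def using ij by simp
  have "cmod (M $$ (i, j)) = cmod ((M *\<^sub>v unit_vec n j) $ i)"
    using M ij by simp
  also have "\<dots> \<le> vec_l2norm (M *\<^sub>v unit_vec n j)"
    using M ij unfolding vec_l2norm_def
    by (intro member_le_L2_set[where f = "\<lambda>k. cmod ((M *\<^sub>v unit_vec n j) $ k)"]) auto
  also have "\<dots> \<le> mat_opnorm M"
    by (rule l2norm_mult_le_opnorm[OF M _ u]) simp
  finally show ?thesis .
qed

text \<open>
  The operator norm dominates every entry.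
\<close>

lemma mat_lim_opnorm:
  assumes X: "\<And>k. X k \<in> carrier_mat n n" and L: "L \<in> carrier_mat n n"
    and d: "\<And>k. mat_opnorm (X k - L) \<le> d k" "d \<longlonglongrightarrow> 0"
  shows "mat_lim n X L"
proof -
  have "(\<lambda>k. X k $$ (i, j)) \<longlonglongrightarrow> L $$ (i, j)" if ij: "i < n" "j < n" for i j
  proof (rule LIM_zero_cancel, rule tendsto_0_le[OF d(2), of _ 1], intro always_eventually allI)
    fix k
    have "X k $$ (i, j) - L $$ (i, j) = (X k - L) $$ (i, j)" using X[of k] L ij by auto
    moreover have "cmod ((X k - L) $$ (i, j)) \<le> d k"
      using entry_le_opnorm[of "X k - L" n, OF _ ij] X[of k] L d(1)[of k]
      by (meson minus_carrier_mat order.trans)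
    ultimately show "norm (X k $$ (i, j) - L $$ (i, j)) \<le> norm (d k) * 1"
      using abs_ge_self[of "d k"] by simp
  qed
  then show ?thesis using X L unfolding mat_lim_def by simp
qed


section \<open>The nonderogatory matrices are open\<close>

text \<open>
  The intermediate dimensions of a product cannot be inferred by rewriting, so they are fixed here.
\<close>

lemmas square_simps =
  assoc_mult_mat[of _ n n _ n _ n] assoc_mult_mat_vec[of _ n n _ n]
  mult_carrier_mat[of _ n n _ n] mult_mat_vec_carrier[of _ n n]
  left_mult_one_mat[of _ n n] right_mult_one_mat[of _ n n] for n

lemma char_matrix_dim [simp]:
  "dim_row (char_matrix A a) = dim_row A" "dim_col (char_matrix A a) = dim_row A"
  unfolding char_matrix_def by simp_all

lemma char_matrix_mult_vec:
  fixes A :: "'a::field mat"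
  assumes "A \<in> carrier_mat n n" "x \<in> carrier_vec n"
  shows "char_matrix A a *\<^sub>v x = A *\<^sub>v x + (- a) \<cdot>\<^sub>v x"
proof (rule eq_vecI)
  fix i assume "i < dim_vec (A *\<^sub>v x + (- a) \<cdot>\<^sub>v x)"
  then have i: "i < n" using assms by simp
  have idx: "char_matrix A a $$ (i, j) = A $$ (i, j) + (if j = i then - a else 0)" if "j < n" for j
    using assms i that unfolding char_matrix_def by auto
  have "(char_matrix A a *\<^sub>v x) $ i = (\<Sum>j<n. char_matrix A a $$ (i, j) * x $ j)"
    using carrier_matD[OF char_matrix_carrier[OF assms(1), of a]] assms(2) i
    by (simp add: scalar_prod_def lessThan_atLeast0)
  also have "\<dots> = (\<Sum>j<n. A $$ (i, j) * x $ j + (if j = i then (- a) * x $ j else 0))"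
    by (intro sum.cong) (auto simp: idx distrib_right)
  also have "\<dots> = (A *\<^sub>v x + (- a) \<cdot>\<^sub>v x) $ i"
    using assms i by (simp add: scalar_prod_def lessThan_atLeast0 sum.distrib)
  finally show "(char_matrix A a *\<^sub>v x) $ i = (A *\<^sub>v x + (- a) \<cdot>\<^sub>v x) $ i" .
qed (use assms in auto)

text \<open>
  Compare both sides of the eigenvalue equation in a coordinate where the eigenvector is largest.
\<close>

lemma eigenvalue_le_sum:
  fixes A :: "complex mat"
  assumes A: "A \<in> carrier_mat n n" and u: "u \<in> carrier_vec n" "u \<noteq> 0\<^sub>v n"
    and eq: "char_matrix A \<mu> *\<^sub>v u = 0\<^sub>v n"
  shows "cmod \<mu> \<le> (\<Sum>i<n. \<Sum>j<n. cmod (A $$ (i, j)))"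
proof -
  have ex: "\<exists>i<n. u $ i \<noteq> 0" using u by (metis eq_vecI carrier_vecD index_zero_vec)
  define S where "S = (\<lambda>i. cmod (u $ i)) ` {..<n}"
  have S: "finite S" "S \<noteq> {}" using ex by (auto simp: S_def)
  obtain i where i: "i < n" "Max S = cmod (u $ i)"
  proof -
    obtain m where m: "m = Max S" "m \<in> S" using Max_in[OF S] by simp
    then obtain i where "i < n" "m = cmod (u $ i)" unfolding S_def by blast
    then show ?thesis using that m by simp
  qed
  have le: "cmod (u $ j) \<le> cmod (u $ i)" if "j < n" for j
  proof -
    have "cmod (u $ j) \<in> S" using that by (simp add: S_def)
    from Max_ge[OF S(1) this] show ?thesis using i(2) by simp
  qed
  obtain l where "l < n" "u $ l \<noteq> 0" using ex by blast
  then have pos: "cmod (u $ i) > 0" using le[of l] by (intro less_le_trans[OF _ le[of l]]) auto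
  have "(A *\<^sub>v u + (- \<mu>) \<cdot>\<^sub>v u) $ i = 0"
    using eq i unfolding char_matrix_mult_vec[OF A u(1)] by simp
  then have "\<mu> * u $ i = (\<Sum>j<n. A $$ (i, j) * u $ j)"
    using A u i by (simp add: scalar_prod_def lessThan_atLeast0)
  then have "cmod \<mu> * cmod (u $ i) = cmod (\<Sum>j<n. A $$ (i, j) * u $ j)"
    by (metis norm_mult)
  also have "\<dots> \<le> (\<Sum>j<n. cmod (A $$ (i, j)) * cmod (u $ j))"
    by (intro sum_norm_le) (simp add: norm_mult)
  also have "\<dots> \<le> (\<Sum>j<n. cmod (A $$ (i, j)) * cmod (u $ i))"
    using le by (intro sum_mono mult_left_mono) auto
  finally have "cmod \<mu> \<le> (\<Sum>j<n. cmod (A $$ (i, j)))"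
    using pos by (simp add: sum_distrib_right[symmetric])
  also have "\<dots> \<le> (\<Sum>i<n. \<Sum>j<n. cmod (A $$ (i, j)))"
    using i by (intro member_le_sum[where f = "\<lambda>i. \<Sum>j<n. cmod (A $$ (i, j))"] sum_nonneg) auto
  finally show ?thesis .
qed

text \<open>
  The multiple eigenvalues stay bounded, so a subsequence of them converges, and the determinant
  criterion passes to the limit.
\<close>

lemma derogatory_limit:
  assumes lim: "mat_lim n A L" and d: "\<And>k. \<not> nonderogatory n (A k)"
  shows "\<not> nonderogatory n L"
proof -
  have "\<exists>\<mu>. \<forall>k. corank_ge2 n (char_matrix (A k) (\<mu> k))"
    using d unfolding nonderogatory_def by (intro choice allI) simp
  then obtain \<mu> where \<mu>: "\<And>k. corank_ge2 n (char_matrix (A k) (\<mu> k))" by blast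
  have "(\<lambda>k. \<Sum>i<n. \<Sum>j<n. cmod (A k $$ (i, j))) \<longlonglongrightarrow> (\<Sum>i<n. \<Sum>j<n. cmod (L $$ (i, j)))"
    by (intro tendsto_sum tendsto_norm mat_limD(3)[OF lim]) auto
  then have "Bseq (\<lambda>k. \<Sum>i<n. \<Sum>j<n. cmod (A k $$ (i, j)))"
    using convergentI convergent_imp_Bseq by blast
  then obtain K where K: "\<And>k. norm (\<Sum>i<n. \<Sum>j<n. cmod (A k $$ (i, j))) \<le> K"
    unfolding Bseq_def by blast
  have "cmod (\<mu> k) \<le> K" for k
  proof -
    obtain u where u: "u \<in> carrier_vec n" "u \<noteq> 0\<^sub>v n" "char_matrix (A k) (\<mu> k) *\<^sub>v u = 0\<^sub>v n"
      using \<mu>[of k] zero_carrier_vec unfolding corank_ge2_def by blast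
    show ?thesis
      using eigenvalue_le_sum[OF mat_limD(1)[OF lim] u] K[of k] by simp
  qed
  then obtain r :: "nat \<Rightarrow> nat" and z where r: "strict_mono r" and z: "\<forall>e>0. \<exists>N. \<forall>k\<ge>N. cmod (\<mu> (r k) - z) < e"
    using Bolzano_Weierstrass_complex_disc[of \<mu> K] by auto
  have "(\<lambda>k. \<mu> (r k)) \<longlonglongrightarrow> z" using z by (intro LIMSEQ_I) auto
  then have clim: "mat_lim n (\<lambda>k. char_matrix (A (r k)) (\<mu> (r k))) (char_matrix L z)"
    by (intro char_matrix_lim mat_lim_subseq[OF lim r])
  have "det (char_matrix L z + dyad n x y) = 0" if "x \<in> carrier_vec n" "y \<in> carrier_vec n" for x y
  proof -
    have "(\<lambda>k. det (char_matrix (A (r k)) (\<mu> (r k)) + dyad n x y)) \<longlonglongrightarrow>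
        det (char_matrix L z + dyad n x y)"
      by (intro det_lim[of n] add_mat_lim clim mat_lim_const dyad_carrier)
    moreover have "det (char_matrix (A (r k)) (\<mu> (r k)) + dyad n x y) = 0" for k
      using \<mu>[of "r k"] that corank_ge2_iff_det[OF char_matrix_carrier[OF mat_limD(1)[OF lim]]] by blast
    ultimately show ?thesis using LIMSEQ_unique[OF _ tendsto_const[of 0]] by simp
  qed
  then show ?thesis
    using corank_ge2_iff_det[OF char_matrix_carrier[OF mat_limD(2)[OF lim]]]
    unfolding nonderogatory_def by blast
qed


section \<open>Eigenvectors of triangular matrices\<close>

text \<open>
  The product of the matrices \<open>A - a\<close> over a list of scalars: the polynomial in \<open>A\<close> with the given
  roots.
\<close>

primrec shift_prod :: "'a::field mat \<Rightarrow> 'a list \<Rightarrow> 'a mat" where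
  "shift_prod A [] = 1\<^sub>m (dim_row A)"
| "shift_prod A (a # as) = char_matrix A a * shift_prod A as"

lemma shift_prod_carrier [simp]:
  "A \<in> carrier_mat n n \<Longrightarrow> shift_prod A as \<in> carrier_mat n n"
  by (induction as) (auto simp: square_simps[where n = n])

lemma char_matrix_mult:
  fixes A :: "'a::field mat"
  assumes "A \<in> carrier_mat n n" "B \<in> carrier_mat n n"
  shows "char_matrix A a * B = A * B + (- a) \<cdot>\<^sub>m B" "B * char_matrix A a = B * A + (- a) \<cdot>\<^sub>m B"
proof -
  have 1: "(- a) \<cdot>\<^sub>m 1\<^sub>m n * B = (- a) \<cdot>\<^sub>m B"
    using assms(2) by (subst mult_smult_assoc_mat[of _ n n _ n]) (auto simp: square_simps[where n = n])
  have 2: "B * ((- a) \<cdot>\<^sub>m 1\<^sub>m n) = (- a) \<cdot>\<^sub>m B"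
    using assms(2) by (subst mult_smult_distrib[of _ n n _ n]) (auto simp: square_simps[where n = n])
  show "char_matrix A a * B = A * B + (- a) \<cdot>\<^sub>m B"
    using assms 1 unfolding char_matrix_def by (simp add: add_mult_distrib_mat[of _ n n])
  show "B * char_matrix A a = B * A + (- a) \<cdot>\<^sub>m B"
    using assms 2 unfolding char_matrix_def by (simp add: mult_add_distrib_mat[of _ n n])
qed

lemma char_matrix_commute:
  fixes A :: "'a::field mat"
  assumes "A \<in> carrier_mat n n" "B \<in> carrier_mat n n" "A * B = B * A"
  shows "char_matrix A a * B = B * char_matrix A a"
  unfolding char_matrix_mult[OF assms(1,2)] assms(3) ..

lemma shift_prod_commute:
  assumes A: "A \<in> carrier_mat n n"
  shows "char_matrix A b * shift_prod A as = shift_prod A as * char_matrix A b"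
proof (induction as)
  case Nil
  then show ?case using A by (simp add: square_simps[where n = n])
next
  case (Cons a as)
  have c: "char_matrix A b * char_matrix A a = char_matrix A a * char_matrix A b"
    using A by (intro char_matrix_commute[of A n] char_matrix_commute[of A n A, symmetric]) auto
  have "char_matrix A b * (char_matrix A a * shift_prod A as)
      = (char_matrix A b * char_matrix A a) * shift_prod A as"
    using A by (simp add: square_simps[where n = n])
  also have "\<dots> = char_matrix A a * (char_matrix A b * shift_prod A as)"
    unfolding c using A by (simp add: square_simps[where n = n])
  also have "\<dots> = (char_matrix A a * shift_prod A as) * char_matrix A b"
    unfolding Cons.IH using A by (simp add: square_simps[where n = n])
  finally show ?case by simp
qed

lemma shift_prod_append:
  assumes A: "A \<in> carrier_mat n n"
  shows "shift_prod A (as @ bs) = shift_prod A as * shift_prod A bs"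
proof (induction as)
  case Nil
  then show ?case using A by (simp add: square_simps[where n = n])
next
  case (Cons a as)
  then show ?case using A by (simp add: square_simps[where n = n])
qed

lemma shift_prod_similar:
  assumes wit: "similar_mat_wit A B P Q" and A: "A \<in> carrier_mat n n"
  shows "shift_prod A as = P * shift_prod B as * Q"
proof (induction as)
  case Nil
  then show ?case using similar_mat_witD2[OF A wit] A by simp
next
  case (Cons a as)
  note w = similar_mat_witD2[OF A wit]
  note w' = similar_mat_witD2[OF char_matrix_carrier[OF A] similar_mat_wit_char_matrix[OF wit, of a]]
  let ?C = "char_matrix B a" and ?S = "shift_prod B as"
  have S: "?S \<in> carrier_mat n n" "?C \<in> carrier_mat n n" using w by auto
  have "shift_prod A (a # as) = (P * ?C * Q) * (P * ?S * Q)"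
    using w'(3) Cons by simp
  also have "\<dots> = P * (?C * ((Q * P) * (?S * Q)))"
    using w(4,5,6,7) S by (simp add: square_simps[where n = n])
  also have "\<dots> = P * (?C * ?S) * Q"
    unfolding w(2) using w(4,5,6,7) S by (simp add: square_simps[where n = n])
  finally show ?case by simp
qed

definition diag_entry :: "'a mat \<Rightarrow> nat \<Rightarrow> 'a" where
  "diag_entry T i = T $$ (i, i)"

text \<open>
  The vectors that vanish beyond position \<open>j\<close> form an invariant subspace, and on its quotient by those
  that also vanish at \<open>j\<close> a triangular matrix acts by its diagonal entry.
\<close>

lemma triangular_mult_vec_support:
  fixes T :: "'a::field mat"
  assumes T: "T \<in> carrier_mat n n" "upper_triangular T" and x: "x \<in> carrier_vec n"
    and supp: "\<And>i. j < i \<Longrightarrow> i < n \<Longrightarrow> x $ i = 0"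
  shows "j < i \<Longrightarrow> i < n \<Longrightarrow> (char_matrix T a *\<^sub>v x) $ i = 0"
    and "j < n \<Longrightarrow> (char_matrix T a *\<^sub>v x) $ j = (T $$ (j, j) - a) * x $ j"
proof -
  have z: "T $$ (i, k) * x $ k = 0" if "j \<le> i" "i < n" "k < n" "k \<noteq> j \<or> i \<noteq> j" for i k
  proof (cases "k < i")
    case True
    then show ?thesis using upper_triangularD[OF T(2) True] T that by simp
  next
    case False
    then show ?thesis using supp[of k] that by auto
  qed
  have e: "(char_matrix T a *\<^sub>v x) $ i = (\<Sum>k<n. T $$ (i, k) * x $ k) - a * x $ i" if "i < n" for i
    using that T x unfolding char_matrix_mult_vec[OF T(1) x]
    by (simp add: scalar_prod_def lessThan_atLeast0)
  show "j < i \<Longrightarrow> i < n \<Longrightarrow> (char_matrix T a *\<^sub>v x) $ i = 0"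
    using e[of i] z[of i] supp[of i] by simp
  show "(char_matrix T a *\<^sub>v x) $ j = (T $$ (j, j) - a) * x $ j" if j: "j < n"
  proof -
    have "(\<Sum>k<n. T $$ (j, k) * x $ k) = (\<Sum>k\<in>{j}. T $$ (j, k) * x $ k)"
      using j z[of j] by (intro sum.mono_neutral_right) auto
    then show ?thesis using e[OF j] by (simp add: algebra_simps)
  qed
qed

lemma shift_prod_mult_vec_support:
  fixes T :: "'a::field mat"
  assumes T: "T \<in> carrier_mat n n" "upper_triangular T" and x: "x \<in> carrier_vec n"
    and supp: "\<And>i. j < i \<Longrightarrow> i < n \<Longrightarrow> x $ i = 0"
  shows "(\<forall>i. j < i \<longrightarrow> i < n \<longrightarrow> (shift_prod T as *\<^sub>v x) $ i = 0) \<and>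
    (j < n \<longrightarrow> (shift_prod T as *\<^sub>v x) $ j = (\<Prod>a\<leftarrow>as. T $$ (j, j) - a) * x $ j)"
proof (induction as)
  case Nil
  then show ?case using T x supp by simp
next
  case (Cons a as)
  let ?y = "shift_prod T as *\<^sub>v x"
  have y: "?y \<in> carrier_vec n" using T x by (meson mult_mat_vec_carrier shift_prod_carrier)
  have "shift_prod T (a # as) *\<^sub>v x = char_matrix T a *\<^sub>v ?y"
    using T x by (simp add: square_simps[where n = n])
  then show ?case
    using triangular_mult_vec_support[OF T y, of j] Cons.IH by (simp add: mult.assoc)
qed

text \<open>
  A relative Cayley-Hamilton theorem: each factor \<open>T - t\<^sub>i\<close> maps the span of the first \<open>i + 1\<close> unit
  vectors into the span of the first \<open>i\<close>. For \<open>j = n\<close> the whole product is zero.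
\<close>

lemma shift_prod_annihilates:
  fixes T :: "'a::field mat"
  assumes T: "T \<in> carrier_mat n n" "upper_triangular T"
  shows "j \<le> n \<Longrightarrow> x \<in> carrier_vec n \<Longrightarrow> (\<And>i. j \<le> i \<Longrightarrow> i < n \<Longrightarrow> x $ i = 0) \<Longrightarrow>
    shift_prod T (map (diag_entry T) [0..<j]) *\<^sub>v x = 0\<^sub>v n"
proof (induction j arbitrary: x)
  case 0
  then have "x = 0\<^sub>v n" by (intro eq_vecI) auto
  then show ?case using T by simp
next
  case (Suc j)
  let ?S = "shift_prod T (map (diag_entry T) [0..<j])" and ?C = "char_matrix T (diag_entry T j)"
  have C: "?C *\<^sub>v x \<in> carrier_vec n" using T Suc.prems(2) by (meson mult_mat_vec_carrier char_matrix_carrier)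
  have "shift_prod T (map (diag_entry T) [0..<Suc j]) *\<^sub>v x = ?S *\<^sub>v (?C *\<^sub>v x)"
    using T Suc.prems(2) by (simp add: shift_prod_append[OF T(1)] square_simps[where n = n])
  moreover have "(?C *\<^sub>v x) $ i = 0" if "j \<le> i" "i < n" for i
    using triangular_mult_vec_support[OF T Suc.prems(2), of j] Suc.prems(1,3) that
    by (cases "i = j") (auto simp: diag_entry_def)
  ultimately show ?case using Suc.IH[OF _ C] Suc.prems(1) by simp
qed

text \<open>
  An eigenvector for the diagonal entry at position \<open>j\<close>, given by a polynomial in \<open>T\<close> and hence
  continuous in \<open>T\<close>. Its entry at \<open>j\<close> is nonzero as soon as no earlier diagonal entry has the same value.
\<close>

definition triangular_eigenvec :: "nat \<Rightarrow> 'a::field mat \<Rightarrow> nat \<Rightarrow> 'a vec" where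
  "triangular_eigenvec n T j = shift_prod T (map (diag_entry T) [0..<j]) *\<^sub>v unit_vec n j"

lemma triangular_eigenvec:
  fixes T :: "'a::field mat"
  assumes T: "T \<in> carrier_mat n n" "upper_triangular T" and j: "j < n"
  shows "triangular_eigenvec n T j \<in> carrier_vec n"
    "char_matrix T (T $$ (j, j)) *\<^sub>v triangular_eigenvec n T j = 0\<^sub>v n"
    "triangular_eigenvec n T j $ j = (\<Prod>i<j. T $$ (j, j) - T $$ (i, i))"
proof -
  let ?S = "shift_prod T (map (diag_entry T) [0..<j])" and ?C = "char_matrix T (T $$ (j, j))"
  have S: "?S \<in> carrier_mat n n" "?C \<in> carrier_mat n n" using T by auto
  show "triangular_eigenvec n T j \<in> carrier_vec n"
    unfolding triangular_eigenvec_def by (meson S mult_mat_vec_carrier unit_vec_carrier)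
  have "?C *\<^sub>v triangular_eigenvec n T j = (?C * ?S) *\<^sub>v unit_vec n j"
    unfolding triangular_eigenvec_def using S by (simp add: square_simps[where n = n])
  also have "?C * ?S = ?S * ?C" by (rule shift_prod_commute[OF T(1)])
  also have "\<dots> *\<^sub>v unit_vec n j = ?S *\<^sub>v (?C *\<^sub>v unit_vec n j)"
    using S by (simp add: square_simps[where n = n])
  also have "\<dots> = 0\<^sub>v n"
  proof (rule shift_prod_annihilates[OF T])
    show "?C *\<^sub>v unit_vec n j \<in> carrier_vec n" by (meson S mult_mat_vec_carrier unit_vec_carrier)
    show "(?C *\<^sub>v unit_vec n j) $ i = 0" if "j \<le> i" "i < n" for i
      using triangular_mult_vec_support[OF T unit_vec_carrier, of j] that j
      by (cases "i = j") auto
  qed (use j in simp)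
  finally show "?C *\<^sub>v triangular_eigenvec n T j = 0\<^sub>v n" .
  have "triangular_eigenvec n T j $ j = (\<Prod>a\<leftarrow>map (diag_entry T) [0..<j]. T $$ (j, j) - a)"
    using shift_prod_mult_vec_support[OF T unit_vec_carrier, of j j] j
    unfolding triangular_eigenvec_def by simp
  also have "\<dots> = (\<Prod>i<j. T $$ (j, j) - T $$ (i, i))"
    by (simp add: diag_entry_def prod.distinct_set_conv_list[symmetric] lessThan_atLeast0 comp_def)
  finally show "triangular_eigenvec n T j $ j = (\<Prod>i<j. T $$ (j, j) - T $$ (i, i))" .
qed

lemma triangular_eigenvec_lim:
  assumes T: "mat_lim n T L" and j: "j < n"
  shows "vec_lim n (\<lambda>k. triangular_eigenvec n (T k) j) (triangular_eigenvec n L j)"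
proof -
  have "mat_lim n (\<lambda>k. shift_prod (T k) (map (diag_entry (T k)) [0..<i]))
      (shift_prod L (map (diag_entry L) [0..<i]))" if "i \<le> n" for i
    using that
  proof (induction i)
    case 0
    then show ?case using mat_lim_dim[OF T] mat_lim_const[of "1\<^sub>m n" n] by simp
  next
    case (Suc i)
    have "mat_lim n (\<lambda>k. char_matrix (T k) (diag_entry (T k) i)) (char_matrix L (diag_entry L i))"
      unfolding diag_entry_def using Suc.prems by (intro char_matrix_lim T mat_limD(3)[OF T]) auto
    from mult_mat_lim[OF Suc.IH this] show ?case
      using mat_limD(1,2)[OF T] mat_lim_dim[OF T] Suc.prems
      by (simp add: shift_prod_append[where n = n] square_simps[where n = n])
  qed
  then show ?thesis
    unfolding triangular_eigenvec_def using j
    by (intro mult_mat_vec_lim vec_lim_const) auto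
qed


section \<open>Choosing the direction of the perturbation\<close>

lemma funpow_mult_vec_carrier [simp]:
  "N \<in> carrier_mat n n \<Longrightarrow> x \<in> carrier_vec n \<Longrightarrow> ((*\<^sub>v) N ^^ a) x \<in> carrier_vec n"
  by (induction a) (auto simp: square_simps[where n = n])

lemma funpow_mult_vec_linear:
  fixes N :: "'a::field mat"
  assumes N: "N \<in> carrier_mat n n" and x: "x \<in> carrier_vec n" and y: "y \<in> carrier_vec n"
  shows "((*\<^sub>v) N ^^ a) (x + c \<cdot>\<^sub>v y) = ((*\<^sub>v) N ^^ a) x + c \<cdot>\<^sub>v ((*\<^sub>v) N ^^ a) y"
proof (induction a)
  case (Suc a)
  have "((*\<^sub>v) N ^^ a) x \<in> carrier_vec n" "((*\<^sub>v) N ^^ a) y \<in> carrier_vec n"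
    using N x y by simp_all
  then show ?case
    using N Suc by (simp add: mult_add_distrib_mat_vec[of N n n] mult_mat_vec[of N n n])
qed simp

lemma funpow_mult_vec_smult:
  fixes N :: "'a::field mat"
  assumes N: "N \<in> carrier_mat n n" and y: "y \<in> carrier_vec n"
  shows "((*\<^sub>v) N ^^ a) (c \<cdot>\<^sub>v y) = c \<cdot>\<^sub>v ((*\<^sub>v) N ^^ a) y"
proof (induction a)
  case (Suc a)
  then show ?case
    using N y by (simp add: mult_mat_vec[of N n n])
qed simp

text \<open>
  Starting from a row vector that kills a product of factors \<open>A - a\<close>, absorb the factors one by one. A
  factor with \<open>a \<noteq> \<mu>\<close> is multiplied into the row vector, which scales its value at the eigenvector
  \<open>v\<close> by \<open>\<mu> - a \<noteq> 0\<close>; a factor with \<open>a = \<mu>\<close> raises the power of \<open>A - \<mu>\<close>.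
\<close>

lemma functional_from_shift_prod:
  fixes A :: "'a::field mat"
  assumes A: "A \<in> carrier_mat n n" and v: "v \<in> carrier_vec n" "char_matrix A \<mu> *\<^sub>v v = 0\<^sub>v n"
  shows "\<omega> \<in> carrier_vec n \<Longrightarrow> \<omega> \<bullet> v \<noteq> 0 \<Longrightarrow>
    \<forall>x\<in>carrier_vec n. \<omega> \<bullet> (shift_prod A as *\<^sub>v ((*\<^sub>v) (char_matrix A \<mu>) ^^ m) x) = 0 \<Longrightarrow>
    \<exists>w\<in>carrier_vec n. \<exists>m. w \<bullet> v \<noteq> 0 \<and>
      (\<forall>x\<in>carrier_vec n. w \<bullet> ((*\<^sub>v) (char_matrix A \<mu>) ^^ m) x = 0)"
proof (induction as arbitrary: \<omega> m)
  case Nil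
  let ?N = "char_matrix A \<mu>"
  have "1\<^sub>m n *\<^sub>v ((*\<^sub>v) ?N ^^ m) x = ((*\<^sub>v) ?N ^^ m) x" if "x \<in> carrier_vec n" for x
    using that A by simp
  then show ?case using Nil A by (intro bexI[of _ \<omega>] exI[of _ m]) auto
next
  case (Cons a as)
  let ?N = "char_matrix A \<mu>" and ?S = "shift_prod A as" and ?C = "char_matrix A a"
  have car: "?N \<in> carrier_mat n n" "?S \<in> carrier_mat n n" "?C \<in> carrier_mat n n" using A by auto
  show ?case
  proof (cases "a = \<mu>")
    case True
    have "\<omega> \<bullet> (?S *\<^sub>v ((*\<^sub>v) ?N ^^ Suc m) x) = 0" if x: "x \<in> carrier_vec n" for x
    proof -
      let ?z = "((*\<^sub>v) ?N ^^ m) x"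
      have z: "?z \<in> carrier_vec n" using x car by simp
      have "?S *\<^sub>v (?N *\<^sub>v ?z) = (?S * ?N) *\<^sub>v ?z"
        using car z by (simp add: square_simps[where n = n])
      also have "?S * ?N = shift_prod A (a # as)"
        using shift_prod_commute[OF A, of \<mu> as] True by simp
      finally show ?thesis using Cons.prems(3) x by simp
    qed
    then show ?thesis using Cons.IH[OF Cons.prems(1,2), of "Suc m"] by blast
  next
    case False
    define \<omega>' where "\<omega>' = ?C\<^sup>T *\<^sub>v \<omega>"
    have \<omega>': "\<omega>' \<in> carrier_vec n"
      unfolding \<omega>'_def using car(3) Cons.prems(1) by (metis mult_mat_vec_carrier transpose_carrier_mat)
    have dot: "\<omega>' \<bullet> z = \<omega> \<bullet> (?C *\<^sub>v z)" if "z \<in> carrier_vec n" for z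
      unfolding \<omega>'_def using scalar_prod_mat_mult_vec[OF car(3) Cons.prems(1) that] by simp
    have Av: "A *\<^sub>v v = \<mu> \<cdot>\<^sub>v v"
    proof (rule eq_vecI)
      fix i assume "i < dim_vec (\<mu> \<cdot>\<^sub>v v)"
      then have i: "i < n" using v by simp
      have "(A *\<^sub>v v + (- \<mu>) \<cdot>\<^sub>v v) $ i = 0"
        using v(2) i unfolding char_matrix_mult_vec[OF A v(1)] by simp
      then show "(A *\<^sub>v v) $ i = (\<mu> \<cdot>\<^sub>v v) $ i" using i v(1) A by simp
    qed (use A v in auto)
    have "?C *\<^sub>v v = (\<mu> - a) \<cdot>\<^sub>v v"
      unfolding char_matrix_mult_vec[OF A v(1)] Av
      using v(1) by (intro eq_vecI) (auto simp: algebra_simps)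
    then have "\<omega>' \<bullet> v = (\<mu> - a) * (\<omega> \<bullet> v)"
      using dot[OF v(1)] Cons.prems(1) v(1) by simp
    then have nz: "\<omega>' \<bullet> v \<noteq> 0" using False Cons.prems(2) by simp
    have "\<omega>' \<bullet> (?S *\<^sub>v ((*\<^sub>v) ?N ^^ m) x) = 0" if x: "x \<in> carrier_vec n" for x
    proof -
      have z: "((*\<^sub>v) ?N ^^ m) x \<in> carrier_vec n" using x car by simp
      then show ?thesis
        using dot[of "?S *\<^sub>v ((*\<^sub>v) ?N ^^ m) x"] Cons.prems(3) x car
        by (simp add: square_simps[where n = n])
    qed
    then show ?thesis using Cons.IH[OF \<omega>' nz] by blast
  qed
qed

text \<open>
  Some row vector detects \<open>v\<close> and vanishes on the image of a power of \<open>A - \<mu>\<close>. It arises from the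
  vanishing of the product of all \<open>A - t\<^sub>i\<close>.
\<close>

lemma exists_functional:
  fixes A :: "complex mat"
  assumes A: "A \<in> carrier_mat n n" and v: "v \<in> carrier_vec n" "v \<noteq> 0\<^sub>v n" "char_matrix A \<mu> *\<^sub>v v = 0\<^sub>v n"
    and wit: "similar_mat_wit A T P Q" and T: "upper_triangular T"
  shows "\<exists>w\<in>carrier_vec n. \<exists>m. w \<bullet> v \<noteq> 0 \<and>
      (\<forall>x\<in>carrier_vec n. w \<bullet> ((*\<^sub>v) (char_matrix A \<mu>) ^^ m) x = 0)"
proof -
  note w = similar_mat_witD2[OF A wit]
  let ?as = "map (diag_entry T) [0..<n]"
  obtain i where i: "i < n" "v $ i \<noteq> 0"
    using v by (metis eq_vecI carrier_vecD index_zero_vec)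
  have zero: "shift_prod A ?as *\<^sub>v x = 0\<^sub>v n" if x: "x \<in> carrier_vec n" for x
  proof -
    have Qx: "Q *\<^sub>v x \<in> carrier_vec n" using w x by (meson mult_mat_vec_carrier)
    have "shift_prod A ?as *\<^sub>v x = P *\<^sub>v (shift_prod T ?as *\<^sub>v (Q *\<^sub>v x))"
      unfolding shift_prod_similar[OF wit A] using w(5,6,7) x
      by (simp add: square_simps[where n = n])
    also have "shift_prod T ?as *\<^sub>v (Q *\<^sub>v x) = 0\<^sub>v n"
      using shift_prod_annihilates[OF w(5) T _ Qx, of n] by simp
    finally show ?thesis using w(6) by simp
  qed
  show ?thesis
    by (rule functional_from_shift_prod[OF A v(1,3), of "unit_vec n i" ?as 0])
      (use zero i v(1) in auto)
qed

text \<open>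
  In terms of Jordan chains: \<open>w\<close> lies in the left chain \<open>w, w N, \<dots>, w N\<^bsup>p\<^esup>\<close>, and \<open>x\<close> is invisible
  to this chain but visible to another left null vector \<open>w'\<close>. A second chain exists because the kernel
  has dimension at least two.
\<close>

lemma exists_direction:
  fixes N :: "'a::field mat"
  assumes N: "N \<in> carrier_mat n n" "corank_ge2 n N"
    and w: "w \<in> carrier_vec n" and v: "v \<in> carrier_vec n" "w \<bullet> v \<noteq> 0"
    and m: "\<forall>x\<in>carrier_vec n. w \<bullet> ((*\<^sub>v) N ^^ m) x = 0"
  obtains p x w' where "x \<in> carrier_vec n" "w' \<in> carrier_vec n"
    "\<And>y. y \<in> carrier_vec n \<Longrightarrow> w \<bullet> ((*\<^sub>v) N ^^ Suc p) y = 0"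
    "\<And>a. a \<le> p \<Longrightarrow> w \<bullet> ((*\<^sub>v) N ^^ a) x = 0"
    "\<And>y. y \<in> carrier_vec n \<Longrightarrow> w' \<bullet> (N *\<^sub>v y) = 0"
    "w' \<bullet> x = 1"
proof -
  \<comment> \<open>Minimality of the exponent makes \<open>w N\<^bsup>p\<^esup>\<close> nonzero, and \<open>f\<close> witnesses this.\<close>
  define q where "q = (LEAST m. \<forall>x\<in>carrier_vec n. w \<bullet> ((*\<^sub>v) N ^^ m) x = 0)"
  have q: "\<forall>x\<in>carrier_vec n. w \<bullet> ((*\<^sub>v) N ^^ q) x = 0"
    unfolding q_def using m by (rule LeastI)
  have "q \<noteq> 0" using q v by (intro notI) auto
  then obtain p where p: "q = Suc p" by (cases q) auto
  have kill: "w \<bullet> ((*\<^sub>v) N ^^ (Suc p + a)) y = 0" if "y \<in> carrier_vec n" for a y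
  proof -
    have "((*\<^sub>v) N ^^ (Suc p + a)) y = ((*\<^sub>v) N ^^ Suc p) (((*\<^sub>v) N ^^ a) y)"
      unfolding funpow_add comp_def ..
    then show ?thesis using q that N(1) unfolding p by simp
  qed
  have "\<not> (\<forall>x\<in>carrier_vec n. w \<bullet> ((*\<^sub>v) N ^^ p) x = 0)"
    using not_less_Least[of p "\<lambda>m. \<forall>x\<in>carrier_vec n. w \<bullet> ((*\<^sub>v) N ^^ m) x = 0"] p
    unfolding q_def by simp
  then obtain f where f: "f \<in> carrier_vec n" "w \<bullet> ((*\<^sub>v) N ^^ p) f \<noteq> 0" by blast
  have NT: "N\<^sup>T \<in> carrier_mat n n" using N by simp
  \<comment> \<open>Vanishing at \<open>f\<close> keeps \<open>w'\<close> from being a multiple of \<open>w N\<^bsup>p\<^esup>\<close>.\<close>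
  obtain w' where w': "w' \<in> carrier_vec n" "w' \<noteq> 0\<^sub>v n" "N\<^sup>T *\<^sub>v w' = 0\<^sub>v n" "f \<bullet> w' = 0"
    using corank_ge2_transpose[OF N] f(1) unfolding corank_ge2_def by blast
  have left: "w' \<bullet> (N *\<^sub>v y) = 0" if "y \<in> carrier_vec n" for y
    using scalar_prod_mat_mult_vec[OF N(1) w'(1) that] w'(3) that by simp
  have w'f: "w' \<bullet> ((*\<^sub>v) N ^^ a) f = 0" for a
  proof (cases a)
    case 0
    then show ?thesis using w'(1,4) f(1) comm_scalar_prod[of f n w'] by simp
  next
    case (Suc b)
    then show ?thesis using left[of "((*\<^sub>v) N ^^ b) f"] N f by simp
  qed
  \<comment> \<open>Adding a multiple of \<open>N\<^bsup>k\<^esup> f\<close> cancels the value of \<open>w N\<^bsup>p-k\<^esup>\<close> without disturbing the higher powers or \<open>w'\<close>.\<close>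
  have "\<exists>x\<in>carrier_vec n. w' \<bullet> x = 1 \<and> (\<forall>i<k. w \<bullet> ((*\<^sub>v) N ^^ (p - i)) x = 0)" if "k \<le> Suc p" for k
    using that
  proof (induction k)
    case 0
    obtain i where i: "i < n" "w' $ i \<noteq> 0"
      using w' by (metis eq_vecI carrier_vecD index_zero_vec)
    then have "w' \<bullet> (inverse (w' $ i) \<cdot>\<^sub>v unit_vec n i) = 1"
      using w' by (simp add: scalar_prod_smult_distrib[of _ n])
    then show ?case by (intro bexI[of _ "inverse (w' $ i) \<cdot>\<^sub>v unit_vec n i"]) auto
  next
    case (Suc k)
    then obtain x where x: "x \<in> carrier_vec n" "w' \<bullet> x = 1"
      and xk: "\<And>i. i < k \<Longrightarrow> w \<bullet> ((*\<^sub>v) N ^^ (p - i)) x = 0" by auto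
    let ?g = "((*\<^sub>v) N ^^ k) f"
    define c where "c = - (w \<bullet> ((*\<^sub>v) N ^^ (p - k)) x) / (w \<bullet> ((*\<^sub>v) N ^^ p) f)"
    have g: "?g \<in> carrier_vec n" using N f by simp
    have lin: "w \<bullet> ((*\<^sub>v) N ^^ a) (x + c \<cdot>\<^sub>v ?g) =
        w \<bullet> ((*\<^sub>v) N ^^ a) x + c * (w \<bullet> ((*\<^sub>v) N ^^ (a + k)) f)" for a
      unfolding funpow_mult_vec_linear[OF N(1) x(1) g]
      using w N x g f by (simp add: scalar_prod_add_distrib[of _ n] funpow_add)
    have "w \<bullet> ((*\<^sub>v) N ^^ (p - i)) (x + c \<cdot>\<^sub>v ?g) = 0" if "i < Suc k" for i
    proof (cases "i = k")
      case True
      then show ?thesis using Suc.prems f(2) unfolding lin by (simp add: c_def)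
    next
      case False
      then have "p - i + k = Suc p + (k - i - 1)" using that Suc.prems by simp
      then show ?thesis
        using kill[OF f(1), of "k - i - 1"] xk[of i] False that unfolding lin by simp
    qed
    moreover have "w' \<bullet> (x + c \<cdot>\<^sub>v ?g) = 1"
      using w'(1) x g w'f[of k] by (simp add: scalar_prod_add_distrib[of _ n])
    ultimately show ?case using x(1) g by (intro bexI[of _ "x + c \<cdot>\<^sub>v ?g"]) auto
  qed
  then obtain x where x: "x \<in> carrier_vec n" "w' \<bullet> x = 1"
    and xk: "\<And>i. i < Suc p \<Longrightarrow> w \<bullet> ((*\<^sub>v) N ^^ (p - i)) x = 0" by blast
  show thesis
  proof (rule that[OF x(1) w'(1)])
    show "w \<bullet> ((*\<^sub>v) N ^^ Suc p) y = 0" if "y \<in> carrier_vec n" for y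
      using kill[OF that, of 0] by simp
    show "w \<bullet> ((*\<^sub>v) N ^^ a) x = 0" if "a \<le> p" for a
      using xk[of "p - a"] that by simp
  qed (use left x in auto)
qed


section \<open>The nonderogatory matrices are dense\<close>

lemma nonderogatory_triangular:
  fixes T :: "complex mat"
  assumes T: "T \<in> carrier_mat n n" "upper_triangular T"
    and inj: "\<And>i j. i < n \<Longrightarrow> j < n \<Longrightarrow> i \<noteq> j \<Longrightarrow> T $$ (i, i) \<noteq> T $$ (j, j)"
  shows "nonderogatory n T"
  unfolding nonderogatory_def
proof (intro allI notI)
  fix \<mu> assume c: "corank_ge2 n (char_matrix T \<mu>)"
  \<comment> \<open>At most one entry of \<open>x\<close> is nonzero, and there the rank-one term fills the only zero on the diagonal.\<close>
  define x where "x = vec n (\<lambda>i. if T $$ (i, i) = \<mu> then 1 else (0 :: complex))"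
  let ?B = "char_matrix T \<mu> + dyad n x x"
  have B: "?B \<in> carrier_mat n n" by simp
  have off: "x $ i * x $ j = 0" if "i < n" "j < n" "i \<noteq> j" for i j
    using inj[OF that] that by (auto simp: x_def)
  have e: "?B $$ (i, j) = T $$ (i, j) + (if i = j then - \<mu> else 0) + x $ i * x $ j" if "i < n" "j < n" for i j
    using that T unfolding char_matrix_def dyad_def by simp
  have "upper_triangular ?B"
    using e off upper_triangularD[OF T(2)] T(1) by (auto simp: dyad_def)
  then have "det ?B = prod_list (diag_mat ?B)" using B by (rule det_upper_triangular)
  moreover have "prod_list (diag_mat ?B) \<noteq> 0"
  proof -
    have "?B $$ (i, i) \<noteq> 0" if "i < n" for i
      unfolding e[OF that that] using that by (cases "T $$ (i, i) = \<mu>") (auto simp: x_def)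
    moreover have "dim_row ?B = n" by (simp add: dyad_def)
    ultimately show ?thesis unfolding prod_list_zero_iff diag_mat_def by auto
  qed
  moreover have "det ?B = 0"
    using iffD1[OF corank_ge2_iff_det[OF char_matrix_carrier[OF T(1)]] c] by (simp add: x_def)
  ultimately show False by simp
qed

lemma nonderogatory_similar:
  assumes "similar_mat_wit A B P Q" "A \<in> carrier_mat n n" "nonderogatory n B"
  shows "nonderogatory n A"
  using assms corank_ge2_similar[OF similar_mat_wit_char_matrix[OF assms(1)] char_matrix_carrier[OF assms(2)]]
  unfolding nonderogatory_def by blast

text \<open>
  Triangularize and move the diagonal entries apart by multiples of a small \<open>t\<close>.
\<close>

lemma nonderogatory_dense:
  fixes A :: "complex mat"
  assumes A: "A \<in> carrier_mat n n" and \<eta>: "0 < \<eta>"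
  obtains B where "B \<in> carrier_mat n n" "nonderogatory n B"
    "\<And>i j. i < n \<Longrightarrow> j < n \<Longrightarrow> cmod (B $$ (i, j) - A $$ (i, j)) \<le> \<eta>"
proof -
  obtain as where "char_poly A = (\<Prod>a\<leftarrow>as. [:- a, 1:])"
    using char_poly_factorized[OF A] by blast
  then obtain T where T: "T \<in> carrier_mat n n" "upper_triangular T" and "similar_mat A T"
    using schur_decomposition_exists[OF A] by blast
  then obtain P Q where wit: "similar_mat_wit A T P Q" unfolding similar_mat_def by blast
  note w = similar_mat_witD2[OF A wit]
  define D where "D = mat n n (\<lambda>(i, j). if i = j then of_nat i else (0 :: complex))"
  have D: "D \<in> carrier_mat n n" by (simp add: D_def)
  define E where "E = P * D * Q"
  have E: "E \<in> carrier_mat n n" unfolding E_def using w D by (simp add: square_simps[where n = n])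
  define C where "C = (\<Sum>i<n. \<Sum>j<n. cmod (E $$ (i, j)))"
  have C: "cmod (E $$ (i, j)) \<le> C" if "i < n" "j < n" for i j
  proof -
    have "cmod (E $$ (i, j)) \<le> (\<Sum>j<n. cmod (E $$ (i, j)))"
      using that by (intro member_le_sum) auto
    also have "\<dots> \<le> C" unfolding C_def
      using that by (intro member_le_sum[where f = "\<lambda>i. \<Sum>j<n. cmod (E $$ (i, j))"] sum_nonneg) auto
    finally show ?thesis .
  qed
  have C0: "0 \<le> C" unfolding C_def by (intro sum_nonneg) auto
  \<comment> \<open>Two diagonal entries can only collide for finitely many values of \<open>t\<close>.\<close>
  define bad where "bad = (\<lambda>(i, j). cmod ((T $$ (j, j) - T $$ (i, i)) / (of_nat i - of_nat j))) ` ({..<n} \<times> {..<n})"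
  have "finite bad" unfolding bad_def by simp
  moreover have "infinite {0<..<\<eta> / (C + 1)}" using \<eta> C0 by (intro infinite_Ioo) simp
  ultimately have "{0<..<\<eta> / (C + 1)} - bad \<noteq> {}" by (metis Diff_infinite_finite finite.emptyI)
  then obtain t where "t \<in> {0<..<\<eta> / (C + 1)} - bad" by blast
  then have t: "0 < t" "t < \<eta> / (C + 1)" "t \<notin> bad" by auto
  define T' where "T' = T + of_real t \<cdot>\<^sub>m D"
  have T': "T' \<in> carrier_mat n n" unfolding T'_def using T D by simp
  have e: "T' $$ (i, j) = T $$ (i, j) + (if i = j then of_real t * of_nat i else 0)" if "i < n" "j < n" for i j
    using that T unfolding T'_def D_def by simp
  have "upper_triangular T'" using T T' e upper_triangularD[OF T(2)] by auto
  moreover have "T' $$ (i, i) \<noteq> T' $$ (j, j)" if ij: "i < n" "j < n" "i \<noteq> j" for i j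
  proof
    assume "T' $$ (i, i) = T' $$ (j, j)"
    then have "T $$ (j, j) - T $$ (i, i) = of_real t * (of_nat i - of_nat j)"
      using e ij by (simp add: algebra_simps)
    moreover have "of_nat i - of_nat j \<noteq> (0 :: complex)" using ij by simp
    ultimately have "(T $$ (j, j) - T $$ (i, i)) / (of_nat i - of_nat j) = of_real t" by simp
    then have "t = cmod ((T $$ (j, j) - T $$ (i, i)) / (of_nat i - of_nat j))"
      using t by simp
    then have "t \<in> bad" unfolding bad_def using ij by (auto intro!: image_eqI[of _ _ "(i, j)"])
    then show False using t by simp
  qed
  ultimately have nd: "nonderogatory n T'" by (intro nonderogatory_triangular T')
  define B where "B = P * T' * Q"
  have B: "B \<in> carrier_mat n n" unfolding B_def using w T' by (simp add: square_simps[where n = n])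
  have "similar_mat_wit B T' P Q"
    using w B T' by (intro similar_mat_witI[of _ _ n]) (auto simp: B_def)
  from nonderogatory_similar[OF this B nd] have ndB: "nonderogatory n B" .
  have "B = (P * T + of_real t \<cdot>\<^sub>m (P * D)) * Q"
    unfolding B_def T'_def using w(5,6,7) D
    by (simp add: mult_add_distrib_mat[of _ n n _ n] mult_smult_distrib[of _ n n _ n])
  also have "\<dots> = P * T * Q + of_real t \<cdot>\<^sub>m E"
    unfolding E_def using w(5,6,7) D
    by (subst add_mult_distrib_mat[of _ n n _ _ n])
      (auto simp: mult_smult_assoc_mat[of _ n n _ n] square_simps[where n = n])
  finally have BA: "B = A + of_real t \<cdot>\<^sub>m E" using w(3) by simp
  have "cmod (B $$ (i, j) - A $$ (i, j)) \<le> \<eta>" if ij: "i < n" "j < n" for i j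
  proof -
    have "B $$ (i, j) - A $$ (i, j) = of_real t * E $$ (i, j)"
      unfolding BA using A E ij by simp
    then have "cmod (B $$ (i, j) - A $$ (i, j)) = t * cmod (E $$ (i, j))"
      using t by (simp add: norm_mult)
    also have "\<dots> \<le> \<eta> / (C + 1) * (C + 1)"
      using t C[OF ij] C0 \<eta> by (intro mult_mono) auto
    finally show ?thesis using C0 by simp
  qed
  then show thesis using that B ndB by blast
qed


section \<open>Eigenvectors of the perturbed matrices\<close>

lemma zero_vec_lim_mult:
  assumes "mat_lim n F (0\<^sub>m n n)" "vec_lim n u v"
  shows "vec_lim n (\<lambda>k. F k *\<^sub>v u k) (0\<^sub>v n)"
proof -
  have "0\<^sub>m n n *\<^sub>v v = 0\<^sub>v n"
    using vec_limD(2)[OF assms(2)] by (intro eq_vecI) (auto simp: scalar_prod_def)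
  then show ?thesis using mult_mat_vec_lim[OF assms] by simp
qed

text \<open>
  The eigenvector equation of \<open>N + s x y\<^sup>T + s\<^bsup>p+1\<^esup> F\<close>, read through \<open>w\<close> and \<open>w'\<close>. The row
  vectors \<open>w N\<^bsup>a\<^esup>\<close> do not see the rank-one term and force \<open>\<zeta>\<^bsup>p+1\<^esup>\<close>
  to be negligible against \<open>s\<^bsup>p+1\<^esup>\<close>; so \<open>\<zeta> / s\<close> tends to zero, and then \<open>w'\<close> shows that
  \<open>y u\<close> tends to zero although its limit is \<open>y v \<noteq> 0\<close>.
\<close>

lemma no_eigenvectors_near:
  fixes N :: "complex mat"
  assumes N: "N \<in> carrier_mat n n"
    and w: "w \<in> carrier_vec n" "w' \<in> carrier_vec n"
    and x: "x \<in> carrier_vec n" and y: "y \<in> carrier_vec n"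
    and kill: "\<And>z. z \<in> carrier_vec n \<Longrightarrow> w \<bullet> ((*\<^sub>v) N ^^ Suc p) z = 0"
    and wx: "\<And>a. a \<le> p \<Longrightarrow> w \<bullet> ((*\<^sub>v) N ^^ a) x = 0"
    and left: "\<And>z. z \<in> carrier_vec n \<Longrightarrow> w' \<bullet> (N *\<^sub>v z) = 0" and w'x: "w' \<bullet> x = 1"
    and v: "w \<bullet> v \<noteq> 0" "y \<bullet> v \<noteq> 0"
    and s: "\<And>k. s k \<noteq> 0" "s \<longlonglongrightarrow> 0"
    and F: "mat_lim n F (0\<^sub>m n n)" and \<zeta>: "\<zeta> \<longlonglongrightarrow> 0" and u: "vec_lim n u v"
    and eq: "\<And>k. (N *\<^sub>v u k + (s k * (y \<bullet> u k)) \<cdot>\<^sub>v x) + (s k ^ Suc p) \<cdot>\<^sub>v (F k *\<^sub>v u k) = \<zeta> k \<cdot>\<^sub>v u k"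
  shows False
proof -
  define e where "e = (\<lambda>k. F k *\<^sub>v u k)"
  have elim: "vec_lim n e (0\<^sub>v n)" unfolding e_def by (rule zero_vec_lim_mult[OF F u])
  note uc = vec_limD(1)[OF u] and ec = vec_limD(1)[OF elim] and vc = vec_limD(2)[OF u]
  have Nu: "N *\<^sub>v u k \<in> carrier_vec n" for k using N uc by (simp add: square_simps[where n = n])
  have dot_lim: "(\<lambda>k. l \<bullet> z k) \<longlonglongrightarrow> l \<bullet> z0" if "l \<in> carrier_vec n" "vec_lim n z z0" for l z z0
    using scalar_prod_lim[OF vec_lim_const[OF that(1)] that(2)] .
  have pow_e: "vec_lim n (\<lambda>k. ((*\<^sub>v) N ^^ a) (e k)) (0\<^sub>v n)" for a
  proof (induction a)
    case 0
    then show ?case using elim by simp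
  next
    case (Suc a)
    then show ?case using mult_mat_vec_lim[OF mat_lim_const[OF N] Suc] N by simp
  qed
  have step: "w \<bullet> ((*\<^sub>v) N ^^ Suc a) (u k) =
      \<zeta> k * (w \<bullet> ((*\<^sub>v) N ^^ a) (u k)) - s k ^ Suc p * (w \<bullet> ((*\<^sub>v) N ^^ a) (e k))"
    if "a \<le> p" for a k
  proof -
    let ?P = "(*\<^sub>v) N ^^ a"
    have pc: "?P z \<in> carrier_vec n" if "z \<in> carrier_vec n" for z using that N by simp
    have "w \<bullet> ?P (\<zeta> k \<cdot>\<^sub>v u k) = \<zeta> k * (w \<bullet> ?P (u k))"
      unfolding funpow_mult_vec_smult[OF N uc] using pc[OF uc[of k]] w(1) by simp
    moreover have "w \<bullet> ?P ((N *\<^sub>v u k + (s k * (y \<bullet> u k)) \<cdot>\<^sub>v x) + (s k ^ Suc p) \<cdot>\<^sub>v e k)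
        = w \<bullet> ?P (N *\<^sub>v u k) + (s k * (y \<bullet> u k)) * (w \<bullet> ?P x) + s k ^ Suc p * (w \<bullet> ?P (e k))"
    proof -
      have c: "N *\<^sub>v u k + (s k * (y \<bullet> u k)) \<cdot>\<^sub>v x \<in> carrier_vec n" using Nu x by simp
      show ?thesis
        unfolding funpow_mult_vec_linear[OF N c ec] funpow_mult_vec_linear[OF N Nu x]
        using pc[OF Nu[of k]] pc[OF x] pc[OF ec[of k]] w(1)
        by (simp add: scalar_prod_add_distrib[of _ n])
    qed
    moreover have "?P (N *\<^sub>v u k) = ((*\<^sub>v) N ^^ Suc a) (u k)" by (simp add: funpow_swap1)
    ultimately show ?thesis using eq[of k] wx[OF that] unfolding e_def by (simp add: algebra_simps)
  qed
  \<comment> \<open>The scaled difference between \<open>\<zeta>\<^bsup>a\<^esup> (w u)\<close> and \<open>w N\<^bsup>a\<^esup> u\<close>; for \<open>a = p + 1\<close> the second term vanishes.\<close>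
  define g where "g = (\<lambda>a k. (\<zeta> k ^ a * (w \<bullet> u k) - w \<bullet> ((*\<^sub>v) N ^^ a) (u k)) / s k ^ Suc p)"
  have g_lim: "g a \<longlonglongrightarrow> 0" if "a \<le> Suc p" for a
    using that
  proof (induction a)
    case 0
    then show ?case by (simp add: g_def)
  next
    case (Suc a)
    have "g (Suc a) = (\<lambda>k. \<zeta> k * g a k + w \<bullet> ((*\<^sub>v) N ^^ a) (e k))"
    proof
      fix k
      show "g (Suc a) k = \<zeta> k * g a k + w \<bullet> ((*\<^sub>v) N ^^ a) (e k)"
        using s(1)[of k] Suc.prems unfolding g_def
        by (subst step) (auto simp: field_simps)
    qed
    moreover have "(\<lambda>k. \<zeta> k * g a k + w \<bullet> ((*\<^sub>v) N ^^ a) (e k)) \<longlonglongrightarrow> 0 * 0 + w \<bullet> 0\<^sub>v n"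
      using Suc by (intro tendsto_add tendsto_mult \<zeta> dot_lim w pow_e) auto
    ultimately show ?case using w by simp
  qed
  have "(\<lambda>k. g (Suc p) k / (w \<bullet> u k)) \<longlonglongrightarrow> 0 / (w \<bullet> v)"
    by (intro tendsto_divide g_lim dot_lim w u v) simp
  moreover have "\<forall>\<^sub>F k in sequentially. g (Suc p) k / (w \<bullet> u k) = (\<zeta> k / s k) ^ Suc p"
  proof -
    have "\<forall>\<^sub>F k in sequentially. w \<bullet> u k \<noteq> 0"
      by (rule tendsto_imp_eventually_ne[OF dot_lim[OF w(1) u] v(1)])
    then show ?thesis
    proof eventually_elim
      case (elim k)
      have "w \<bullet> ((*\<^sub>v) N ^^ Suc p) (u k) = 0" by (rule kill[OF uc])
      then show ?case using elim s(1)[of k] unfolding g_def by (simp add: power_divide del: funpow.simps power_Suc)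
    qed
  qed
  ultimately have "(\<lambda>k. (\<zeta> k / s k) ^ Suc p) \<longlonglongrightarrow> 0"
    by (simp add: tendsto_cong)
  then have "(\<lambda>k. cmod (\<zeta> k / s k) ^ Suc p) \<longlonglongrightarrow> 0"
    unfolding norm_power[symmetric] by (rule tendsto_norm_zero)
  then have "(\<lambda>k. cmod (\<zeta> k / s k)) \<longlonglongrightarrow> 0"
    using power_tendsto_0_iff[of "Suc p" "\<lambda>k. cmod (\<zeta> k / s k)"] by blast
  then have ratio: "(\<lambda>k. \<zeta> k / s k) \<longlonglongrightarrow> 0"
    by (rule tendsto_norm_zero_cancel)
  have yu: "y \<bullet> u k = (\<zeta> k / s k) * (w' \<bullet> u k) - s k ^ p * (w' \<bullet> e k)" for k
  proof -
    have "w' \<bullet> ((N *\<^sub>v u k + (s k * (y \<bullet> u k)) \<cdot>\<^sub>v x) + (s k ^ Suc p) \<cdot>\<^sub>v e k) = \<zeta> k * (w' \<bullet> u k)"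
      using eq[of k] w uc unfolding e_def by simp
    then have "s k * (y \<bullet> u k) + s k ^ Suc p * (w' \<bullet> e k) = \<zeta> k * (w' \<bullet> u k)"
      using left[OF uc, of k] w'x Nu[of k] ec[of k] x w by (simp add: scalar_prod_add_distrib[of _ n])
    then show ?thesis using s(1)[of k] by (simp add: field_simps)
  qed
  have "(\<lambda>k. (\<zeta> k / s k) * (w' \<bullet> u k) - s k ^ p * (w' \<bullet> e k)) \<longlonglongrightarrow> 0 * (w' \<bullet> v) - 0 ^ p * (w' \<bullet> 0\<^sub>v n)"
    by (intro tendsto_diff tendsto_mult tendsto_power ratio s dot_lim w u elim)
  then have "(\<lambda>k. y \<bullet> u k) \<longlonglongrightarrow> 0" unfolding yu[symmetric] using w by simp
  then show False using LIMSEQ_unique dot_lim[OF y u] v(2) by blast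
qed


section \<open>Matrices without a nearby Schur factorization\<close>

lemma schur_factorization_similar:
  assumes "(U, T) \<in> schur_factorizations n A"
  shows "similar_mat_wit A T U (mat_adjoint U)" "U \<in> carrier_mat n n" "T \<in> carrier_mat n n"
    "upper_triangular T" "A = U * T * mat_adjoint U" "A \<in> carrier_mat n n"
proof -
  have *: "unitary_mat n U" "T \<in> carrier_mat n n" "upper_triangular T" "A = U * T * mat_adjoint U"
    using assms unfolding schur_factorizations_def by auto
  then have U: "U \<in> carrier_mat n n" "U * mat_adjoint U = 1\<^sub>m n" "mat_adjoint U * U = 1\<^sub>m n"
    unfolding unitary_mat_def by auto
  then show A: "A \<in> carrier_mat n n" using * by (simp add: square_simps[where n = n])
  show "similar_mat_wit A T U (mat_adjoint U)"
    using U * A by (intro similar_mat_witI[of _ _ n]) auto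
qed (use assms in \<open>auto simp: schur_factorizations_def unitary_mat_def\<close>)

lemma corank_ge2_triangular_diag:
  fixes T :: "'a::field mat"
  assumes T: "T \<in> carrier_mat n n" "upper_triangular T" and c: "corank_ge2 n (char_matrix T \<mu>)"
  shows "\<exists>i<n. T $$ (i, i) = \<mu>"
proof (rule ccontr)
  assume "\<not> ?thesis"
  then have d: "T $$ (i, i) \<noteq> \<mu>" if "i < n" for i using that by blast
  let ?C = "char_matrix T \<mu>"
  have C: "?C \<in> carrier_mat n n" using T by simp
  have e: "?C $$ (i, j) = T $$ (i, j) + (if i = j then - \<mu> else 0)" if "i < n" "j < n" for i j
    using that T unfolding char_matrix_def by simp
  have "upper_triangular ?C" using e upper_triangularD[OF T(2)] T(1) by auto
  then have "det ?C = prod_list (diag_mat ?C)" using C by (rule det_upper_triangular)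
  also have "\<dots> \<noteq> 0"
    using e d T(1) unfolding prod_list_zero_iff diag_mat_def by auto
  finally have "det ?C \<noteq> 0" .
  moreover obtain u where "u \<in> carrier_vec n" "u \<noteq> 0\<^sub>v n" "?C *\<^sub>v u = 0\<^sub>v n"
    using c zero_carrier_vec unfolding corank_ge2_def by blast
  ultimately show False using det_0_iff_vec_prod_zero[OF C] by blast
qed

lemma similar_eigenvec:
  fixes A :: "'a::field mat"
  assumes wit: "similar_mat_wit A T P Q" and A: "A \<in> carrier_mat n n"
    and c: "c \<in> carrier_vec n" "char_matrix T \<mu> *\<^sub>v c = 0\<^sub>v n"
  shows "char_matrix A \<mu> *\<^sub>v (P *\<^sub>v c) = 0\<^sub>v n" "Q *\<^sub>v (P *\<^sub>v c) = c"
proof -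
  note w = similar_mat_witD2[OF char_matrix_carrier[OF A] similar_mat_wit_char_matrix[OF wit, of \<mu>]]
  have "Q *\<^sub>v (P *\<^sub>v c) = (Q * P) *\<^sub>v c" using w(6,7) c by (simp add: square_simps[where n = n])
  then show Q: "Q *\<^sub>v (P *\<^sub>v c) = c" using w(2) c by simp
  have "char_matrix A \<mu> *\<^sub>v (P *\<^sub>v c) = P *\<^sub>v (char_matrix T \<mu> *\<^sub>v (Q *\<^sub>v (P *\<^sub>v c)))"
    unfolding w(3) using w(5,6,7) c by (simp add: square_simps[where n = n])
  also have "\<dots> = 0\<^sub>v n" unfolding Q c(2) using w(6) by simp
  finally show "char_matrix A \<mu> *\<^sub>v (P *\<^sub>v c) = 0\<^sub>v n" .
qed

text \<open>
  The scale \<open>s\<close> is fixed first, small against \<open>\<epsilon>\<close>; the correction that makes the matrix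
  nonderogatory is then chosen small against \<open>s\<^bsup>p+1\<^esup>\<close>.
\<close>

lemma exists_perturbation:
  fixes A :: "complex mat"
  assumes A: "A \<in> carrier_mat n n" and \<epsilon>: "0 < \<epsilon>" and \<delta>: "0 < (\<delta> :: real)"
  obtains s B F where "0 < s" "s \<le> \<delta>" "B \<in> carrier_mat n n" "F \<in> carrier_mat n n" "nonderogatory n B"
    "mat_opnorm (B - A) < \<epsilon>"
    "B = (A + complex_of_real s \<cdot>\<^sub>m dyad n x y) + (complex_of_real s ^ Suc p) \<cdot>\<^sub>m F"
    "\<And>i j. i < n \<Longrightarrow> j < n \<Longrightarrow> cmod (F $$ (i, j)) \<le> \<delta>"
proof -
  \<comment> \<open>The entries of \<open>B - A\<close> are at most \<open>s\<close> times the summands of \<open>C\<close>, where the \<open>1\<close> pays for the correction.\<close>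
  define C where "C = (\<Sum>i<n. \<Sum>j<n. cmod (dyad n x y $$ (i, j)) + 1)"
  have C: "0 \<le> C" unfolding C_def by (intro sum_nonneg) auto
  define d where "d = min \<delta> 1"
  have d: "0 < d" "d \<le> \<delta>" "d \<le> 1" using \<delta> unfolding d_def by auto
  define s where "s = min d (\<epsilon> / (C + 1))"
  have "s \<le> \<epsilon> / (C + 1)" unfolding s_def by simp
  then have s: "0 < s" "s \<le> d" "s * (C + 1) \<le> \<epsilon>"
    using d C \<epsilon> pos_le_divide_eq[of "C + 1" s \<epsilon>] unfolding s_def by auto
  define \<eta> where "\<eta> = s ^ Suc p * d"
  have "s ^ Suc p \<le> s" using s d power_decreasing[of 1 "Suc p" s] by simp
  then have "s ^ Suc p * d \<le> s * 1" using s d by (intro mult_mono) auto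
  then have \<eta>: "0 < \<eta>" "\<eta> \<le> s" using s d unfolding \<eta>_def by simp_all
  let ?A1 = "A + complex_of_real s \<cdot>\<^sub>m dyad n x y"
  have A1: "?A1 \<in> carrier_mat n n" using A by simp
  obtain B where B: "B \<in> carrier_mat n n" "nonderogatory n B"
    and Bc: "\<And>i j. i < n \<Longrightarrow> j < n \<Longrightarrow> cmod (B $$ (i, j) - ?A1 $$ (i, j)) \<le> \<eta>"
    by (rule nonderogatory_dense[OF A1 \<eta>(1)]) blast
  define F where "F = mat n n (\<lambda>(i, j). (B $$ (i, j) - ?A1 $$ (i, j)) / complex_of_real s ^ Suc p)"
  have F: "F \<in> carrier_mat n n" unfolding F_def by simp
  have Fc: "cmod (F $$ (i, j)) \<le> \<delta>" if ij: "i < n" "j < n" for i j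
  proof -
    have "cmod (F $$ (i, j)) = cmod (B $$ (i, j) - ?A1 $$ (i, j)) / s ^ Suc p"
      using ij s unfolding F_def by (simp add: norm_divide norm_power norm_mult)
    also have "\<dots> \<le> \<eta> / s ^ Suc p" using Bc[OF ij] s by (intro divide_right_mono) auto
    also have "\<dots> = d" using s unfolding \<eta>_def by simp
    finally show ?thesis using d by simp
  qed
  have "B = ?A1 + (complex_of_real s ^ Suc p) \<cdot>\<^sub>m F"
  proof (rule eq_matI)
    fix i j assume "i < dim_row (?A1 + (complex_of_real s ^ Suc p) \<cdot>\<^sub>m F)"
      "j < dim_col (?A1 + (complex_of_real s ^ Suc p) \<cdot>\<^sub>m F)"
    then have ij: "i < n" "j < n" using F by auto
    have "(?A1 + (complex_of_real s ^ Suc p) \<cdot>\<^sub>m F) $$ (i, j) =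
        ?A1 $$ (i, j) + complex_of_real s ^ Suc p * F $$ (i, j)"
      using ij F by simp
    also have "complex_of_real s ^ Suc p * F $$ (i, j) = B $$ (i, j) - ?A1 $$ (i, j)"
      using ij s unfolding F_def by simp
    finally show "B $$ (i, j) = (?A1 + (complex_of_real s ^ Suc p) \<cdot>\<^sub>m F) $$ (i, j)" by simp
  qed (use B F in auto)
  moreover have "mat_opnorm (B - A) < \<epsilon>"
  proof -
    have entry: "cmod ((B - A) $$ (i, j)) \<le> s * (cmod (dyad n x y $$ (i, j)) + 1)" if ij: "i < n" "j < n" for i j
    proof -
      have dc: "dyad n x y \<in> carrier_mat n n" by simp
      have "(B - A) $$ (i, j) = (B $$ (i, j) - ?A1 $$ (i, j)) + complex_of_real s * dyad n x y $$ (i, j)"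
        using ij A B carrier_matD[OF dc] by simp
      also have "cmod \<dots> \<le> cmod (B $$ (i, j) - ?A1 $$ (i, j)) + s * cmod (dyad n x y $$ (i, j))"
        using s by (intro norm_triangle_le) (simp add: norm_mult)
      also have "\<dots> \<le> s * (cmod (dyad n x y $$ (i, j)) + 1)"
        using Bc[OF ij] \<eta> by (simp add: distrib_left)
      finally show ?thesis .
    qed
    have "mat_opnorm (B - A) \<le> (\<Sum>i<n. \<Sum>j<n. cmod ((B - A) $$ (i, j)))"
      using A B by (intro opnorm_le_sum) auto
    also have "\<dots> \<le> (\<Sum>i<n. \<Sum>j<n. s * (cmod (dyad n x y $$ (i, j)) + 1))"
      by (intro sum_mono entry) auto
    also have "\<dots> = s * C" unfolding C_def sum_distrib_left ..
    also have "\<dots> < s * (C + 1)" using s by simp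
    also have "\<dots> \<le> \<epsilon>" by (rule s)
    finally show ?thesis .
  qed
  ultimately show thesis using that[of s B F] s d B F Fc by simp
qed

lemma schur_limits:
  assumes near: "\<And>k. (U k, T k) \<in> schur_factorizations n (A k)"
    and S0: "(U\<^sub>0, T\<^sub>0) \<in> schur_factorizations n A\<^sub>0"
    and d: "\<And>k. mat_opnorm (U k - U\<^sub>0) + mat_opnorm (T k - T\<^sub>0) < d k" "d \<longlonglongrightarrow> 0"
  shows "mat_lim n U U\<^sub>0" "mat_lim n T T\<^sub>0" "mat_lim n A A\<^sub>0"
proof -
  note s = schur_factorization_similar[OF near] and s0 = schur_factorization_similar[OF S0]
  have "0 \<le> mat_opnorm (U k - U\<^sub>0)" "0 \<le> mat_opnorm (T k - T\<^sub>0)" for k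
    using s(2,3)[of k] s0(2,3) by (auto intro!: opnorm_nonneg[of _ n])
  then have "mat_opnorm (U k - U\<^sub>0) \<le> d k" "mat_opnorm (T k - T\<^sub>0) \<le> d k" for k
    using d(1)[of k] add_increasing2[of "mat_opnorm (T k - T\<^sub>0)" "mat_opnorm (U k - U\<^sub>0)"]
    by (meson add_increasing add_increasing2 le_less_trans less_imp_le order_refl)+
  then show U: "mat_lim n U U\<^sub>0" and T: "mat_lim n T T\<^sub>0"
    using mat_lim_opnorm[OF s(2) s0(2) _ d(2)] mat_lim_opnorm[OF s(3) s0(3) _ d(2)] by auto
  have "mat_lim n (\<lambda>k. U k * T k * mat_adjoint (U k)) (U\<^sub>0 * T\<^sub>0 * mat_adjoint U\<^sub>0)"
    by (intro mult_mat_lim mat_adjoint_lim U T)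
  then show "mat_lim n A A\<^sub>0" unfolding s(5)[symmetric] s0(5)[symmetric] .
qed

text \<open>
  A Schur factorization near \<open>(U\<^sub>0, T\<^sub>0)\<close> carries an eigenvector near a fixed eigenvector of
  \<open>A\<^sub>0\<close>, which the perturbations constructed above do not have.
\<close>

lemma derogatory_schur_far:
  assumes S0: "(U\<^sub>0, T\<^sub>0) \<in> schur_factorizations n A\<^sub>0" and d0: "\<not> nonderogatory n A\<^sub>0"
    and \<epsilon>: "\<And>k. 0 < \<epsilon> k" and d: "d \<longlonglongrightarrow> 0"
    and near: "\<And>k A. A \<in> gk_different_nbhd n A\<^sub>0 (\<epsilon> k) \<Longrightarrow>
      \<exists>(U, T) \<in> schur_factorizations n A. mat_opnorm (U - U\<^sub>0) + mat_opnorm (T - T\<^sub>0) < d k"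
  shows False
proof -
  note s0 = schur_factorization_similar[OF S0]
  note A0 = s0(6)
  obtain \<mu> where \<mu>: "corank_ge2 n (char_matrix A\<^sub>0 \<mu>)" using d0 unfolding nonderogatory_def by blast
  let ?N = "char_matrix A\<^sub>0 \<mu>"
  have N: "?N \<in> carrier_mat n n" using A0 by simp
  have cT: "corank_ge2 n (char_matrix T\<^sub>0 \<mu>)"
    by (rule corank_ge2_similar[OF similar_mat_wit_char_matrix[OF s0(1)] N \<mu>])
  \<comment> \<open>At the first occurrence of \<open>\<mu>\<close> the entry of \<open>c\<close> at \<open>j\<close> is a product of nonzero factors.\<close>
  define j where "j = (LEAST i. i < n \<and> T\<^sub>0 $$ (i, i) = \<mu>)"
  have j: "j < n" "T\<^sub>0 $$ (j, j) = \<mu>"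
    using LeastI_ex[OF corank_ge2_triangular_diag[OF s0(3,4) cT]] unfolding j_def by auto
  have jmin: "T\<^sub>0 $$ (i, i) \<noteq> \<mu>" if "i < j" for i
    using not_less_Least[of i "\<lambda>i. i < n \<and> T\<^sub>0 $$ (i, i) = \<mu>"] that j(1) unfolding j_def by auto
  define c where "c = triangular_eigenvec n T\<^sub>0 j"
  note ev = triangular_eigenvec[OF s0(3,4) j(1), folded c_def]
  have "c $ j \<noteq> 0" unfolding ev(3) using j(2) jmin by fastforce
  then have c0: "c \<noteq> 0\<^sub>v n" using j(1) by auto
  define v where "v = U\<^sub>0 *\<^sub>v c"
  note se = similar_eigenvec[OF s0(1) A0 ev(1), of \<mu>, folded v_def]
  have v: "v \<in> carrier_vec n" "char_matrix A\<^sub>0 \<mu> *\<^sub>v v = 0\<^sub>v n" "v \<noteq> 0\<^sub>v n"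
  proof -
    show "v \<in> carrier_vec n" unfolding v_def using s0(2) ev(1) by (simp add: square_simps[where n = n])
    show "char_matrix A\<^sub>0 \<mu> *\<^sub>v v = 0\<^sub>v n" using se(1) ev(2) j(2) by simp
    show "v \<noteq> 0\<^sub>v n" 
      using se(2) ev(2) j(2) c0 carrier_matD[OF mat_adjoint_carrier[OF s0(2)]] by auto
  qed
  obtain w m where w: "w \<in> carrier_vec n" "w \<bullet> v \<noteq> 0"
    and m: "\<forall>x\<in>carrier_vec n. w \<bullet> ((*\<^sub>v) ?N ^^ m) x = 0"
    using exists_functional[OF A0 v(1,3,2) s0(1,4)] by blast
  obtain p x w' where x: "x \<in> carrier_vec n" and w': "w' \<in> carrier_vec n"
    and kill: "\<And>y. y \<in> carrier_vec n \<Longrightarrow> w \<bullet> ((*\<^sub>v) ?N ^^ Suc p) y = 0"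
    and wx: "\<And>a. a \<le> p \<Longrightarrow> w \<bullet> ((*\<^sub>v) ?N ^^ a) x = 0"
    and left: "\<And>y. y \<in> carrier_vec n \<Longrightarrow> w' \<bullet> (?N *\<^sub>v y) = 0" and w'x: "w' \<bullet> x = 1"
    by (rule exists_direction[OF N \<mu> w(1) v(1) w(2) m]) blast
  obtain i where i: "i < n" "v $ i \<noteq> 0"
    using v by (metis eq_vecI carrier_vecD index_zero_vec)
  define y :: "complex vec" where "y = unit_vec n i"
  have y: "y \<in> carrier_vec n" "y \<bullet> v \<noteq> 0" using i v(1) unfolding y_def by auto
  define P where "P = (\<lambda>k s B F. 0 < s \<and> s \<le> 1 / real (Suc k) \<and> B \<in> carrier_mat n n \<and> F \<in> carrier_mat n n \<and>
    nonderogatory n B \<and> mat_opnorm (B - A\<^sub>0) < \<epsilon> k \<and>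
    B = (A\<^sub>0 + complex_of_real s \<cdot>\<^sub>m dyad n x y) + (complex_of_real s ^ Suc p) \<cdot>\<^sub>m F \<and>
    (\<forall>i<n. \<forall>j<n. cmod (F $$ (i, j)) \<le> 1 / real (Suc k)))"
  have "\<exists>s B F. P k s B F" for k
  proof -
    have "0 < 1 / real (Suc k)" by simp
    from exists_perturbation[OF A0 \<epsilon>[of k] this, of x y p] show ?thesis
      unfolding P_def by metis
  qed
  then obtain s B F where sBF: "\<And>k. P k (s k) (B k) (F k)" by metis
  have null_seq: "f \<longlonglongrightarrow> 0" if "\<And>k. cmod (f k) \<le> g k" "g \<longlonglongrightarrow> 0" for f g
    using that by (intro tendsto_norm_zero_cancel[OF tendsto_sandwich[OF _ _ tendsto_const that(2)]]) auto
  have inv0: "(\<lambda>k. 1 / real (Suc k)) \<longlonglongrightarrow> 0" using LIMSEQ_inverse_real_of_nat by (simp add: inverse_eq_divide)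
  note P = sBF[unfolded P_def]
  have Bc: "B k \<in> carrier_mat n n" and Fc: "F k \<in> carrier_mat n n" and nd: "nonderogatory n (B k)"
    and Beq: "B k = (A\<^sub>0 + complex_of_real (s k) \<cdot>\<^sub>m dyad n x y) + (complex_of_real (s k) ^ Suc p) \<cdot>\<^sub>m F k"
    for k using P[of k] by blast+
  have "s \<longlonglongrightarrow> 0"
    using P by (intro tendsto_sandwich[OF _ _ tendsto_const inv0] always_eventually allI) (auto intro: less_imp_le)
  then have slim: "(\<lambda>k. complex_of_real (s k)) \<longlonglongrightarrow> 0"
    using tendsto_of_real[of s 0 sequentially] by simp
  have Flim: "mat_lim n F (0\<^sub>m n n)"
  proof -
    have "(\<lambda>k. F k $$ (a, b)) \<longlonglongrightarrow> 0" if "a < n" "b < n" for a b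
      using P that by (intro null_seq[OF _ inv0]) blast
    then show ?thesis using Fc unfolding mat_lim_def by simp
  qed
  have "B k \<in> gk_different_nbhd n A\<^sub>0 (\<epsilon> k)" for k
    using P[of k] gk_different_nonderogatory_derogatory[OF Bc nd A0 d0, of k]
    unfolding gk_different_nbhd_def by blast
  then have "\<exists>U T. (U, T) \<in> schur_factorizations n (B k) \<and>
      mat_opnorm (U - U\<^sub>0) + mat_opnorm (T - T\<^sub>0) < d k" for k
    using near[of "B k" k] by blast
  then obtain U T where UT: "\<And>k. (U k, T k) \<in> schur_factorizations n (B k)"
    and UTd: "\<And>k. mat_opnorm (U k - U\<^sub>0) + mat_opnorm (T k - T\<^sub>0) < d k" by metis
  note lim = schur_limits[OF UT S0 UTd d]
  note sk = schur_factorization_similar[OF UT]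
  define u where "u = (\<lambda>k. U k *\<^sub>v triangular_eigenvec n (T k) j)"
  have ulim: "vec_lim n u v"
    unfolding u_def v_def c_def by (intro mult_mat_vec_lim lim triangular_eigenvec_lim j)
  note uc = vec_limD(1)[OF ulim]
  define \<zeta> where "\<zeta> = (\<lambda>k. T k $$ (j, j) - \<mu>)"
  have zlim: "\<zeta> \<longlonglongrightarrow> 0"
    using tendsto_diff[OF mat_limD(3)[OF lim(2) j(1) j(1)] tendsto_const[of \<mu>]] j(2) unfolding \<zeta>_def by simp
  show False
  proof (rule no_eigenvectors_near[OF N w(1) w' x y(1) kill wx left w'x w(2) y(2) _ slim Flim zlim ulim])
    show "complex_of_real (s k) \<noteq> 0" for k using P[of k] by simp
    fix k
    let ?s = "complex_of_real (s k)"
    have bu: "char_matrix (B k) (T k $$ (j, j)) *\<^sub>v u k = 0\<^sub>v n"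
      unfolding u_def using triangular_eigenvec[OF sk(3,4) j(1), of k]
      by (intro similar_eigenvec(1)[OF sk(1) Bc]) auto
    have A0u: "A\<^sub>0 *\<^sub>v u k \<in> carrier_vec n" "F k *\<^sub>v u k \<in> carrier_vec n"
      using A0 Fc uc by (simp_all add: square_simps[where n = n])
    have Bu: "B k *\<^sub>v u k = (A\<^sub>0 *\<^sub>v u k + (?s * (y \<bullet> u k)) \<cdot>\<^sub>v x) + (?s ^ Suc p) \<cdot>\<^sub>v (F k *\<^sub>v u k)"
    proof -
      have sm: "(a \<cdot>\<^sub>m M) *\<^sub>v u k = a \<cdot>\<^sub>v (M *\<^sub>v u k)" if "M \<in> carrier_mat n n" for M a
        using that uc[of k] by (intro eq_vecI) auto
      have "B k *\<^sub>v u k = ((A\<^sub>0 + ?s \<cdot>\<^sub>m dyad n x y) + (?s ^ Suc p) \<cdot>\<^sub>m F k) *\<^sub>v u k"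
        using Beq[of k] by simp
      also have "\<dots> = (A\<^sub>0 *\<^sub>v u k + (?s \<cdot>\<^sub>m dyad n x y) *\<^sub>v u k) + ((?s ^ Suc p) \<cdot>\<^sub>m F k) *\<^sub>v u k"
        using A0 Fc[of k] uc[of k] 
        by (simp add: add_mult_distrib_mat_vec[of _ n n] assoc_add_vec[of _ n]
            square_simps[where n = n] del: power_Suc)
      also have "\<dots> = (A\<^sub>0 *\<^sub>v u k + (?s * (y \<bullet> u k)) \<cdot>\<^sub>v x) + (?s ^ Suc p) \<cdot>\<^sub>v (F k *\<^sub>v u k)"
        unfolding sm[OF dyad_carrier] sm[OF Fc] dyad_mult_vec[OF x y(1) uc] smult_smult_assoc ..
      finally show ?thesis .
    qed
    show "(?N *\<^sub>v u k + (?s * (y \<bullet> u k)) \<cdot>\<^sub>v x) + (?s ^ Suc p) \<cdot>\<^sub>v (F k *\<^sub>v u k) = \<zeta> k \<cdot>\<^sub>v u k"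
    proof (rule eq_vecI)
      fix l assume "l < dim_vec (\<zeta> k \<cdot>\<^sub>v u k)"
      then have l: "l < n" using uc[of k] by simp
      have "(B k *\<^sub>v u k + (- T k $$ (j, j)) \<cdot>\<^sub>v u k) $ l = 0"
        using bu l unfolding char_matrix_mult_vec[OF Bc uc] by simp
      then have "(B k *\<^sub>v u k) $ l = T k $$ (j, j) * u k $ l"
        using uc[of k] l by (simp del: index_mult_mat_vec)
      then show "((?N *\<^sub>v u k + (?s * (y \<bullet> u k)) \<cdot>\<^sub>v x) + (?s ^ Suc p) \<cdot>\<^sub>v (F k *\<^sub>v u k)) $ l = (\<zeta> k \<cdot>\<^sub>v u k) $ l"
        unfolding Bu char_matrix_mult_vec[OF A0 uc]
        using uc[of k] A0u x l carrier_vecD[OF A0u(1)] carrier_vecD[OF A0u(2)]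
        by (simp add: \<zeta>_def algebra_simps del: index_mult_mat_vec power_Suc dim_mult_mat_vec)
    qed (use uc[of k] A0u carrier_vecD[OF A0u(2)] in auto)
  qed
qed

theorem theorem1p6:
  fixes n :: nat and A\<^sub>0 U\<^sub>0 T\<^sub>0 :: "complex mat"
  assumes "A\<^sub>0 \<in> carrier_mat n n"
    and "(U\<^sub>0, T\<^sub>0) \<in> schur_factorizations n A\<^sub>0"
  shows "\<exists>M::real. M > 0 \<and>
           (\<forall>\<epsilon>::real. \<epsilon> > 0 \<longrightarrow> gk_different_nbhd n A\<^sub>0 \<epsilon> \<noteq> {} \<longrightarrow>
              (SUP A \<in> gk_different_nbhd n A\<^sub>0 \<epsilon>.
                 INF (U, T) \<in> schur_factorizations n A.
                   ereal (mat_opnorm (U - U\<^sub>0) + mat_opnorm (T - T\<^sub>0))) > ereal M)"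
proof (rule ccontr)
  assume neg: "\<not> ?thesis"
  define D where "D = (\<lambda>A. INF (U, T) \<in> schur_factorizations n A.
    ereal (mat_opnorm (U - U\<^sub>0) + mat_opnorm (T - T\<^sub>0)))"
  \<comment> \<open>The factor two turns the bound on the infimum into a strict one, which some factorization satisfies.\<close>
  define d where "d = (\<lambda>k. 2 * (1 / real (Suc k)))"
  have "\<exists>\<epsilon>. \<epsilon> > 0 \<and> gk_different_nbhd n A\<^sub>0 \<epsilon> \<noteq> {} \<and>
      (SUP A \<in> gk_different_nbhd n A\<^sub>0 \<epsilon>. D A) \<le> ereal (1 / real (Suc k))" for k
  proof -
    have "1 / real (Suc k) > 0" by simp
    then show ?thesis using neg unfolding D_def by (meson not_le)
  qed
  then obtain \<epsilon> where \<epsilon>: "\<And>k. \<epsilon> k > 0" and ne: "\<And>k. gk_different_nbhd n A\<^sub>0 (\<epsilon> k) \<noteq> {}"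
    and sup: "\<And>k. (SUP A \<in> gk_different_nbhd n A\<^sub>0 (\<epsilon> k). D A) \<le> ereal (1 / real (Suc k))" by metis
  have near: "\<exists>(U, T) \<in> schur_factorizations n A. mat_opnorm (U - U\<^sub>0) + mat_opnorm (T - T\<^sub>0) < d k"
    if "A \<in> gk_different_nbhd n A\<^sub>0 (\<epsilon> k)" for k A
  proof -
    have "D A \<le> ereal (1 / real (Suc k))" using SUP_upper[OF that, of D] sup[of k] by (rule order.trans)
    also have "\<dots> < ereal (d k)"
    proof -
      have "0 < 1 / real (Suc k)" by simp
      then have "1 / real (Suc k) < d k" unfolding d_def by linarith
      then show ?thesis by (simp only: less_ereal.simps)
    qed
    finally have "\<exists>UT \<in> schur_factorizations n A.
        (case UT of (U, T) \<Rightarrow> ereal (mat_opnorm (U - U\<^sub>0) + mat_opnorm (T - T\<^sub>0))) < ereal (d k)"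
      unfolding D_def INF_less_iff .
    then obtain U T where "(U, T) \<in> schur_factorizations n A"
      "mat_opnorm (U - U\<^sub>0) + mat_opnorm (T - T\<^sub>0) < d k" by auto
    then show ?thesis by blast
  qed
  have "(\<lambda>k. 1 / real (Suc k)) \<longlonglongrightarrow> 0"
    using LIMSEQ_inverse_real_of_nat by (simp add: inverse_eq_divide)
  then have d: "d \<longlonglongrightarrow> 0" unfolding d_def using tendsto_mult_right_zero by blast
  have "\<exists>A. A \<in> gk_different_nbhd n A\<^sub>0 (\<epsilon> k)" for k using ne by blast
  then obtain A where A: "\<And>k. A k \<in> gk_different_nbhd n A\<^sub>0 (\<epsilon> k)" by metis
  have "\<exists>U T. (U, T) \<in> schur_factorizations n (A k) \<and>
      mat_opnorm (U - U\<^sub>0) + mat_opnorm (T - T\<^sub>0) < d k" for k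
    using near[OF A[of k]] by blast
  then obtain U T where UT: "\<And>k. (U k, T k) \<in> schur_factorizations n (A k)"
    and UTd: "\<And>k. mat_opnorm (U k - U\<^sub>0) + mat_opnorm (T k - T\<^sub>0) < d k" by metis
  have Alim: "mat_lim n A A\<^sub>0" by (rule schur_limits(3)[OF UT assms(2) UTd d])
  have "\<not> nonderogatory n A\<^sub>0"
  proof
    assume nd: "nonderogatory n A\<^sub>0"
    have "\<not> nonderogatory n (A k)" for k
      using A[of k] not_gk_different_nonderogatory[OF _ _ assms(1) nd]
      unfolding gk_different_nbhd_def by blast
    from derogatory_limit[OF Alim this] nd show False by blast
  qed
  from derogatory_schur_far[OF assms(2) this \<epsilon> d near] show False .
qed

end
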